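(* Let $d\ge 1$ and $k\ge 2$ be integers. Then $\mathbb{A}(k)$, with the norm $\|\cdot\|_{\mathbb{A}(k)}$ and pointwise multiplication of functions, is a Banach algebra; in particular, if $g^1,g^2\in\mathbb{A}(k)$ then $g^1g^2\in\mathbb{A}(k)$ and $\|g^1g^2\|_{\mathbb{A}(k)}\le\|g^1\|_{\mathbb{A}(k)}\|g^2\|_{\mathbb{A}(k)}$.
   Context: A Banach algebra (not required to be unital) is a Banach space with an associative bilinear product whose norm is submultiplicative. Functions are real-valued. Let $\tilde V_k=\{0,1\}^k\setminus\{\vec 0\}$ and $q_k=\frac{2^k-1}{k}$. For $\vec h=(h_1,\dots,h_k)\in(\mathbb{R}^d)^k$ and $\alpha\in\tilde V_k$ put $\alpha\cdot\vec h=\alpha_1h_1+\cdots+\alpha_kh_k\in\mathbb{R}^d$. The cubic convolution product is $$D_k(f_\alpha:\alpha\in\tilde V_k)(x)=\int_{\mathbb{R}^{kd}}\prod_{\alpha\in\tilde V_k}f_\alpha(x+\alpha\cdot\vec h)\,d\vec h .$$ Let $\mathcal{K}(k)$ be the convex hull of $$\Big\{D_k(f_\alpha:\alpha\in\tilde V_k): f_\alpha\in L^{q_k}(\mathbb{R}^d)\text{ for all }\alpha\in\tilde V_k,\ \prod_{\alpha\in\tilde V_k}\|f_\alpha\|_{q_k}\le 1\Big\}.$$ These are bounded continuous functions on $\mathbb{R}^d$. Let $\mathcal{C}$ be the space of bounded continuous functions on $\mathbb{R}^d$ with the uniform norm $\|\cdot\|_\infty$, and let $\bar{\mathcal{K}}(k)$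 be the closure of $\mathcal{K}(k)$ in $(\mathcal{C},\|\cdot\|_\infty)$. Then $\mathbb{A}(k)$ is the linear subspace of $\mathcal{C}$ spanned by $\bar{\mathcal{K}}(k)$, endowed with the norm $\|\cdot\|_{\mathbb{A}(k)}$ whose closed unit ball is $\bar{\mathcal{K}}(k)$, i.e. $\|g\|_{\mathbb{A}(k)}=\inf\{t>0: g\in t\,\bar{\mathcal{K}}(k)\}$. *)

theory Defs
  imports "HOL-Analysis.Analysis"
begin

definition cube_vertices :: "nat \<Rightarrow> (nat \<Rightarrow> real) set" where
  "cube_vertices k = ({..<k} \<rightarrow>\<^sub>E {0, 1}) - {\<lambda>i\<in>{..<k}. 0}"

definition q_exp :: "nat \<Rightarrow> real" where
  "q_exp k = (2 ^ k - 1) / real k"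

definition cube_dot :: "nat \<Rightarrow> (nat \<Rightarrow> real) \<Rightarrow> (nat \<Rightarrow> 'a) \<Rightarrow> 'a::real_vector" where
  "cube_dot k \<alpha> h = (\<Sum>i<k. \<alpha> i *\<^sub>R h i)"

text \<open>Elements of \<open>L\<^sup>q\<close> are given by Borel representatives.\<close>

definition Lq :: "real \<Rightarrow> ('a::euclidean_space \<Rightarrow> real) set" where
  "Lq q = {f \<in> borel_measurable lborel. integrable lborel (\<lambda>x. \<bar>f x\<bar> powr q)}"

definition Lq_norm :: "real \<Rightarrow> ('a::euclidean_space \<Rightarrow> real) \<Rightarrow> real" where
  "Lq_norm q f = (LINT x|lborel. \<bar>f x\<bar> powr q) powr (1 / q)"

definition cubic_conv ::
    "nat \<Rightarrow> ((nat \<Rightarrow> real) \<Rightarrow> 'a::euclidean_space \<Rightarrow> real) \<Rightarrow> 'a \<Rightarrow> real" where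
  "cubic_conv k f x =
    (LINT h|PiM {..<k} (\<lambda>_. lborel). (\<Prod>\<alpha>\<in>cube_vertices k. f \<alpha> (x + cube_dot k \<alpha> h)))"

text \<open>For \<open>k \<ge> 2\<close> every \<open>cubic_conv k f\<close> with all \<open>f \<alpha>\<close> in \<open>L\<^sup>q\<close>, \<open>q = q_exp k\<close>, is
  bounded and continuous, so looking for it among the bounded continuous functions
  loses nothing.\<close>

definition K_set :: "nat \<Rightarrow> ('a::euclidean_space \<Rightarrow>\<^sub>C real) set" where
  "K_set k = convex hull
    {g. \<exists>f. (\<forall>\<alpha>\<in>cube_vertices k. f \<alpha> \<in> Lq (q_exp k)) \<and>
            (\<Prod>\<alpha>\<in>cube_vertices k. Lq_norm (q_exp k) (f \<alpha>)) \<le> 1 \<and>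
            apply_bcontfun g = cubic_conv k f}"

definition A_space :: "nat \<Rightarrow> ('a::euclidean_space \<Rightarrow>\<^sub>C real) set" where
  "A_space k = span (closure (K_set k))"

definition A_norm :: "nat \<Rightarrow> ('a::euclidean_space \<Rightarrow>\<^sub>C real) \<Rightarrow> real" where
  "A_norm k g = Inf {t. t > 0 \<and> g \<in> (\<lambda>u. t *\<^sub>R u) ` closure (K_set k)}"

definition bcontfun_mult ::
    "('a::topological_space \<Rightarrow>\<^sub>C real) \<Rightarrow> ('a \<Rightarrow>\<^sub>C real) \<Rightarrow> ('a \<Rightarrow>\<^sub>C real)" where
  "bcontfun_mult f g = Bcontfun (\<lambda>x. apply_bcontfun f x * apply_bcontfun g x)"

lemma apply_bcontfun_mult [simp]:
  "apply_bcontfun (bcontfun_mult f g) x = apply_bcontfun f x * apply_bcontfun g x"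
proof -
  obtain a b where a: "\<And>x. \<bar>apply_bcontfun f x\<bar> \<le> a" and b: "\<And>x. \<bar>apply_bcontfun g x\<bar> \<le> b"
    using bounded_apply_bcontfun[of f] bounded_apply_bcontfun[of g]
    unfolding bounded_iff by auto
  have "\<bar>apply_bcontfun f x * apply_bcontfun g x\<bar> \<le> a * b" for x
    unfolding abs_mult using a[of x] b[of x] by (intro mult_mono) auto
  then have "bounded (range (\<lambda>x. apply_bcontfun f x * apply_bcontfun g x))"
    unfolding bounded_iff by auto
  then have "(\<lambda>x. apply_bcontfun f x * apply_bcontfun g x) \<in> bcontfun"
    unfolding bcontfun_def by (auto intro: continuous_on_mult)
  then show ?thesis
    unfolding bcontfun_mult_def by (simp add: Bcontfun_inverse)
qed

text \<open>A Banach algebra, not necessarily unital, carried by a linear subspace \<open>A\<close> of an ambient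
  real vector space; the norm \<open>N\<close> is unrelated to any norm of the ambient space.\<close>

locale banach_algebra_on =
  fixes A :: "'v::real_vector set" and N :: "'v \<Rightarrow> real" and mult :: "'v \<Rightarrow> 'v \<Rightarrow> 'v"
  assumes subspace: "subspace A"
    and norm_nonneg: "x \<in> A \<Longrightarrow> 0 \<le> N x"
    and norm_eq_0_iff: "x \<in> A \<Longrightarrow> N x = 0 \<longleftrightarrow> x = 0"
    and norm_scaleR: "x \<in> A \<Longrightarrow> N (c *\<^sub>R x) = \<bar>c\<bar> * N x"
    and norm_triangle: "x \<in> A \<Longrightarrow> y \<in> A \<Longrightarrow> N (x + y) \<le> N x + N y"
    and complete: "(\<And>n. X n \<in> A) \<Longrightarrow>
      (\<And>e. e > 0 \<Longrightarrow> \<exists>M. \<forall>m\<ge>M. \<forall>n\<ge>M. N (X m - X n) < e) \<Longrightarrow>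
      \<exists>L\<in>A. (\<lambda>n. N (X n - L)) \<longlonglongrightarrow> 0"
    and mult_closed: "x \<in> A \<Longrightarrow> y \<in> A \<Longrightarrow> mult x y \<in> A"
    and mult_assoc: "x \<in> A \<Longrightarrow> y \<in> A \<Longrightarrow> z \<in> A \<Longrightarrow> mult (mult x y) z = mult x (mult y z)"
    and mult_add_left: "x \<in> A \<Longrightarrow> y \<in> A \<Longrightarrow> z \<in> A \<Longrightarrow> mult (x + y) z = mult x z + mult y z"
    and mult_add_right: "x \<in> A \<Longrightarrow> y \<in> A \<Longrightarrow> z \<in> A \<Longrightarrow> mult x (y + z) = mult x y + mult x z"
    and mult_scaleR_left: "x \<in> A \<Longrightarrow> y \<in> A \<Longrightarrow> mult (c *\<^sub>R x) y = c *\<^sub>R mult x y"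
    and mult_scaleR_right: "x \<in> A \<Longrightarrow> y \<in> A \<Longrightarrow> mult x (c *\<^sub>R y) = c *\<^sub>R mult x y"
    and norm_mult: "x \<in> A \<Longrightarrow> y \<in> A \<Longrightarrow> N (mult x y) \<le> N x * N y"

end

theory Submission
  imports Defs
begin

text \<open>
  Write \<open>D f\<close> for the cubic convolution product and \<open>q = q_exp k\<close>. The space \<open>A_space k\<close> is the span of the
  closed convex symmetric bounded set \<open>closure (K_set k)\<close> under its Minkowski gauge. For such a set in a
  complete space the gauge is a complete norm on the span, and it is submultiplicative as soon as the
  set is closed under multiplication (locale \<open>banach_disc\<close>). So two facts are needed.

  Boundedness is the inequality \<open>\<bar>D f x\<bar> \<le> \<Prod>\<^sub>\<alpha> \<parallel>f\<^sub>\<alpha>\<parallel>\<^sub>q\<close> with constant exactly one (\<open>abs_cubic_conv_le\<close>). If \<open>B\<close> is a set of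
  \<open>k\<close> cube vertices with determinant \<open>\<plusminus>1\<close>, a linear change of variables gives
  \<open>\<integral> \<Prod>\<^bsub>\<beta>\<in>B\<^esub> G\<^sub>\<beta>(\<beta>\<cdot>h) dh = \<Prod>\<^bsub>\<beta>\<in>B\<^esub> \<integral> G\<^sub>\<beta>\<close>. There is a probability distribution on such sets under which every
  vertex is covered with the same probability, necessarily \<open>k / (2\<^sup>k - 1) = 1 / q\<close> (\<open>basis_average_uniform\<close>).
  Hence \<open>\<Prod>\<^sub>\<alpha> \<bar>f\<^sub>\<alpha>(\<alpha>\<cdot>h)\<bar>\<close> is a weighted geometric mean of the products \<open>\<Prod>\<^bsub>\<beta>\<in>B\<^esub> \<bar>f\<^sub>\<beta>(\<beta>\<cdot>h)\<bar>\<^sup>q\<close>, and the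
  inequality of arithmetic and geometric means finishes the argument after normalisation.

  Closedness under multiplication rests on using the same inequality twice. Substituting \<open>h + t\<close> for the
  integration variable of the second factor yields
  \<open>D f x \<cdot> D f' x = \<integral> D(F\<^sub>t) x dt\<close> with \<open>F\<^sub>t\<^sub>,\<^sub>\<alpha>(y) = f\<^sub>\<alpha>(y) f'\<^sub>\<alpha>(y + \<alpha>\<cdot>t)\<close> (\<open>cubic_conv_mult\<close>).
  The function \<open>D(F\<^sub>t)\<close> lies in \<open>N(t)\<close> times the unit ball, where \<open>N(t) = \<Prod>\<^sub>\<alpha> U\<^sub>\<alpha>(\<alpha>\<cdot>t)\<close> and
  \<open>U\<^sub>\<alpha>(u)\<close> is the \<open>L\<^sup>q\<close> norm of \<open>f\<^sub>\<alpha>(y) f'\<^sub>\<alpha>(y + u)\<close> in \<open>y\<close>. The inequality, applied to the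
  functions \<open>U\<^sub>\<alpha>\<close>, bounds \<open>\<integral> N\<close> by \<open>\<Prod>\<^sub>\<alpha> \<parallel>U\<^sub>\<alpha>\<parallel>\<^sub>q\<close>, and Tonelli's theorem gives \<open>\<parallel>U\<^sub>\<alpha>\<parallel>\<^sub>q = \<parallel>f\<^sub>\<alpha>\<parallel>\<^sub>q \<parallel>f'\<^sub>\<alpha>\<parallel>\<^sub>q\<close>. So
  the product of two generators is a barycentre of points of the unit ball, which belongs to it because the
  ball is closed and convex (\<open>barycentre_mem_closed_convex\<close>). To have a norm-continuous integrand this is
  carried out for continuous functions of compact support; the general case follows because these are dense
  in \<open>L\<^sup>q\<close> and \<open>D\<close> is continuous from \<open>L\<^sup>q\<close> to the uniform norm (\<open>cubic_conv_uniform_limit\<close>).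
\<close>

section \<open>Vertices of the cube\<close>

definition zero_vertex :: "nat \<Rightarrow> nat \<Rightarrow> real" where
  "zero_vertex k = (\<lambda>i\<in>{..<k}. 0)"

lemma cube_vertices_eq: "cube_vertices k = ({..<k} \<rightarrow>\<^sub>E {0, 1}) - {zero_vertex k}"
  by (simp add: cube_vertices_def zero_vertex_def)

lemma finite_cube_vertices: "finite (cube_vertices k)"
  unfolding cube_vertices_def by (intro finite_Diff finite_PiE) auto

lemma cube_vertices_0: "cube_vertices 0 = {}"
  unfolding cube_vertices_def by (auto simp: restrict_def)

lemma cube_vertices_undefined: "\<alpha> \<in> cube_vertices k \<Longrightarrow> \<alpha> k = undefined"
  unfolding cube_vertices_def by (auto simp: PiE_def extensional_def)

lemma cube_vertices_upd_undefined: "\<alpha> \<in> cube_vertices k \<Longrightarrow> (\<alpha>(k := e))(k := undefined) = \<alpha>"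
  using cube_vertices_undefined[of \<alpha> k] by auto

lemma zero_vertex_upd_undefined: "((zero_vertex k)(k := e))(k := undefined) = zero_vertex k"
  by (auto simp: zero_vertex_def)

lemma zero_vertex_notin: "zero_vertex k \<notin> cube_vertices k"
  unfolding cube_vertices_eq by auto

text \<open>The inductions on the dimension below rest on this splitting: a nonzero vertex in dimension \<open>k + 1\<close> is either
  the last unit vector or one of the two lifts of a nonzero vertex in dimension \<open>k\<close>.\<close>

lemma cube_vertices_Suc_cases:
  assumes "\<beta> \<in> cube_vertices (Suc k)"
  obtains "\<beta> = (zero_vertex k)(k := 1)"
    | \<alpha> e where "\<alpha> \<in> cube_vertices k" "e \<in> {0, 1}" "\<beta> = \<alpha>(k := e)"
proof -
  define \<alpha> where "\<alpha> = \<beta>(k := undefined)"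
  have 1: "\<alpha> \<in> {..<k} \<rightarrow>\<^sub>E {0, 1}" "\<beta> k \<in> {0, 1}"
    using assms unfolding cube_vertices_def \<alpha>_def
    by (auto simp: PiE_iff extensional_def lessThan_Suc)
  have 2: "\<beta> = \<alpha>(k := \<beta> k)" unfolding \<alpha>_def by auto
  show thesis
  proof (cases "\<alpha> = zero_vertex k")
    case True
    have "\<beta> k \<noteq> 0"
    proof
      assume "\<beta> k = 0"
      then have "\<beta> = zero_vertex (Suc k)"
        using 2 unfolding True by (auto simp: fun_eq_iff zero_vertex_def restrict_def split: if_splits)
      with assms show False by (simp add: zero_vertex_notin)
    qed
    then show thesis using that(1) 1 2 True by auto
  next
    case False
    then show thesis using that(2)[of \<alpha> "\<beta> k"] 1 2 by (auto simp: cube_vertices_eq)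
  qed
qed

lemma cube_vertices_updI:
  assumes "\<alpha> \<in> cube_vertices k" "e \<in> {0, 1}"
  shows "\<alpha>(k := e) \<in> cube_vertices (Suc k)"
proof -
  have "\<alpha>(k := e) \<noteq> zero_vertex (Suc k)"
  proof
    assume eq: "\<alpha>(k := e) = zero_vertex (Suc k)"
    have "\<alpha> i = zero_vertex k i" for i
      using fun_cong[OF eq, of i] cube_vertices_undefined[OF assms(1)]
      by (cases "i = k") (auto simp: zero_vertex_def restrict_def less_Suc_eq split: if_splits)
    then have "\<alpha> = zero_vertex k" ..
    with assms(1) show False by (simp add: zero_vertex_notin)
  qed
  then show ?thesis
    using assms unfolding cube_vertices_eq
    by (auto simp: PiE_iff extensional_def lessThan_Suc)
qed

lemma cube_vertices_zero_updI: "(zero_vertex k)(k := 1) \<in> cube_vertices (Suc k)"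
proof -
  have "(zero_vertex k)(k := 1) \<noteq> zero_vertex (Suc k)"
    by (auto simp: zero_vertex_def dest: fun_cong[of _ _ k])
  then show ?thesis
    unfolding cube_vertices_eq by (auto simp: zero_vertex_def PiE_iff extensional_def lessThan_Suc)
qed

section \<open>Unimodular bases made of cube vertices\<close>

text \<open>A recursively generated supply of vertex sets that are bases of determinant \<open>\<plusminus>1\<close>: lift all elements of a basis
  to the same level \<open>e\<close>, then add either the last unit vector or the lift of one element to the other level. The
  second choice adds the unit vector up to sign, since the two lifts of \<open>\<gamma>\<close> differ by it. The determinant itself
  never appears: \<open>nn_integral_cube_basis\<close> takes its place.\<close>

inductive cube_basis :: "nat \<Rightarrow> (nat \<Rightarrow> real) set \<Rightarrow> bool" where
  empty: "cube_basis 0 {}"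
| add_axis: "cube_basis k B \<Longrightarrow> e \<in> {0, 1} \<Longrightarrow>
    cube_basis (Suc k) (insert ((zero_vertex k)(k := 1)) ((\<lambda>\<beta>. \<beta>(k := e)) ` B))"
| double_vertex: "cube_basis k B \<Longrightarrow> e \<in> {0, 1} \<Longrightarrow> \<gamma> \<in> B \<Longrightarrow>
    cube_basis (Suc k) (insert (\<gamma>(k := 1 - e)) ((\<lambda>\<beta>. \<beta>(k := e)) ` B))"

lemma inj_on_upd: "B \<subseteq> cube_vertices k \<Longrightarrow> inj_on (\<lambda>\<beta>. \<beta>(k := e)) B"
  by (rule inj_onI) (metis cube_vertices_upd_undefined subsetD)

lemma zero_upd_notin: "B \<subseteq> cube_vertices k \<Longrightarrow> (zero_vertex k)(k := 1) \<notin> (\<lambda>\<beta>. \<beta>(k := e)) ` B"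
proof
  assume B: "B \<subseteq> cube_vertices k" and "(zero_vertex k)(k := 1) \<in> (\<lambda>\<beta>. \<beta>(k := e)) ` B"
  then obtain \<beta> where \<beta>: "\<beta> \<in> B" "(zero_vertex k)(k := 1) = \<beta>(k := e)" by blast
  have "zero_vertex k = \<beta>"
    using arg_cong[OF \<beta>(2), of "\<lambda>f. f(k := undefined)"] \<beta>(1) B
    by (metis cube_vertices_upd_undefined zero_vertex_upd_undefined subsetD)
  with \<beta>(1) B show False using zero_vertex_notin by blast
qed

lemma double_upd_notin:
  assumes "e \<in> {0, 1::real}" 
  shows "\<gamma>(k := 1 - e) \<notin> (\<lambda>\<beta>. \<beta>(k := e)) ` B"
proof
  assume "\<gamma>(k := 1 - e) \<in> (\<lambda>\<beta>. \<beta>(k := e)) ` B"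
  then obtain \<beta> where "\<gamma>(k := 1 - e) = \<beta>(k := e)" by auto
  from fun_cong[OF this, of k] assms show False by auto
qed

lemma cube_basis_subset: "cube_basis k B \<Longrightarrow> B \<subseteq> cube_vertices k"
  by (induction rule: cube_basis.induct)
     (auto intro!: cube_vertices_updI cube_vertices_zero_updI)

lemma cube_basis_finite: "cube_basis k B \<Longrightarrow> finite B"
  using cube_basis_subset finite_cube_vertices finite_subset by blast

lemma cube_basis_card: "cube_basis k B \<Longrightarrow> card B = k"
proof (induction rule: cube_basis.induct)
  case (add_axis k B e)
  then show ?case
    using zero_upd_notin[OF cube_basis_subset] inj_on_upd[OF cube_basis_subset, of k B e]
    by (simp add: card_image cube_basis_finite)
next
  case (double_vertex k B e \<gamma>)
  then show ?case
    using double_upd_notin[of e \<gamma> k B] inj_on_upd[OF cube_basis_subset, of k B e]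
    by (simp add: card_image cube_basis_finite)
qed simp

text \<open>Convex combinations of indicator functions of such bases, regarded as functions on the vertices only. The number
  \<open>c \<alpha>\<close> is the probability that a random basis contains \<open>\<alpha>\<close>, so that \<open>c\<close> ranges over the admissible exponents
  in the integral inequality.\<close>

inductive basis_average :: "nat \<Rightarrow> ((nat \<Rightarrow> real) \<Rightarrow> real) \<Rightarrow> bool" for k where
  basis: "cube_basis k B \<Longrightarrow> (\<And>\<alpha>. \<alpha> \<in> cube_vertices k \<Longrightarrow> c \<alpha> = indicator B \<alpha>) \<Longrightarrow>
    basis_average k c"
| mix: "basis_average k c1 \<Longrightarrow> basis_average k c2 \<Longrightarrow> 0 \<le> u \<Longrightarrow> u \<le> 1 \<Longrightarrow>
    (\<And>\<alpha>. \<alpha> \<in> cube_vertices k \<Longrightarrow> c \<alpha> = u * c1 \<alpha> + (1 - u) * c2 \<alpha>) \<Longrightarrow> basis_average k c"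

lemma basis_average_midpoint:
  assumes "basis_average k c1" "basis_average k c2"
  shows "basis_average k (\<lambda>\<alpha>. (c1 \<alpha> + c2 \<alpha>) / 2)"
  by (rule basis_average.mix[OF assms, of "1/2"]) auto

lemma basis_average_mean:
  assumes "finite J" "J \<noteq> {}" "\<And>j. j \<in> J \<Longrightarrow> basis_average k (c j)"
  shows "basis_average k (\<lambda>\<alpha>. (\<Sum>j\<in>J. c j \<alpha>) / real (card J))"
  using assms
proof (induction rule: finite_ne_induct)
  case (singleton x)
  then show ?case by simp
next
  case (insert x F)
  show ?case
  proof (rule basis_average.mix)
    show "basis_average k (c x)" "basis_average k (\<lambda>\<alpha>. (\<Sum>j\<in>F. c j \<alpha>) / real (card F))"
      using insert by auto
    show "0 \<le> 1 / (1 + real (card F))" "1 / (1 + real (card F)) \<le> 1" by auto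
    fix \<alpha>
    have "real (card F) > 0" using insert by (simp add: card_gt_0_iff)
    then have "1 - 1 / (1 + real (card F)) = real (card F) / (1 + real (card F))"
      by (simp add: field_simps)
    then show "(\<Sum>j\<in>insert x F. c j \<alpha>) / real (card (insert x F))
      = 1 / (1 + real (card F)) * c x \<alpha>
        + (1 - 1 / (1 + real (card F))) * ((\<Sum>j\<in>F. c j \<alpha>) / real (card F))"
      using insert \<open>real (card F) > 0\<close> by (simp add: add_divide_distrib)
  qed
qed

text \<open>How the covering probabilities change when every basis in a convex combination is extended by the last unit
  vector (\<open>axis_lift\<close>), or by the opposite lift of a uniformly chosen element (\<open>double_lift\<close>). Resetting coordinate
  \<open>k\<close> to \<open>undefined\<close> recovers the underlying vertex in dimension \<open>k\<close>.\<close>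

definition axis_lift ::
    "nat \<Rightarrow> real \<Rightarrow> ((nat \<Rightarrow> real) \<Rightarrow> real) \<Rightarrow> (nat \<Rightarrow> real) \<Rightarrow> real" where
  "axis_lift k e c \<beta> = (if \<beta>(k := undefined) = zero_vertex k then 1
     else if \<beta> k = e then c (\<beta>(k := undefined)) else 0)"

definition double_lift ::
    "nat \<Rightarrow> real \<Rightarrow> ((nat \<Rightarrow> real) \<Rightarrow> real) \<Rightarrow> (nat \<Rightarrow> real) \<Rightarrow> real" where
  "double_lift k e c \<beta> = (if \<beta>(k := undefined) = zero_vertex k then 0
     else c (\<beta>(k := undefined)) * (if \<beta> k = e then 1 else 1 / real k))"

lemma upd_undefined_eq_zero_iff:
  "\<alpha> \<in> cube_vertices k \<Longrightarrow> (\<alpha>(k := e))(k := undefined) = zero_vertex k \<longleftrightarrow> False"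
  by (metis cube_vertices_upd_undefined zero_vertex_notin)

lemma upd_mem_image_iff:
  assumes "B \<subseteq> cube_vertices k" "\<alpha> \<in> cube_vertices k"
  shows "\<alpha>(k := e) \<in> (\<lambda>\<beta>. \<beta>(k := e')) ` B \<longleftrightarrow> \<alpha> \<in> B \<and> e = e'"
proof
  assume "\<alpha>(k := e) \<in> (\<lambda>\<beta>. \<beta>(k := e')) ` B"
  then obtain \<beta> where \<beta>: "\<beta> \<in> B" "\<alpha>(k := e) = \<beta>(k := e')" by auto
  have "\<alpha> = \<beta>"
    using arg_cong[OF \<beta>(2), of "\<lambda>f. f(k := undefined)"] \<beta>(1) assms
    by (metis cube_vertices_upd_undefined subsetD)
  with \<beta>(1) fun_cong[OF \<beta>(2), of k] show "\<alpha> \<in> B \<and> e = e'" by simp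
qed auto

lemma upd_eq_iff:
  assumes "\<gamma> \<in> cube_vertices k" "\<alpha> \<in> cube_vertices k"
  shows "\<alpha>(k := e) = \<gamma>(k := e') \<longleftrightarrow> \<alpha> = \<gamma> \<and> e = e'"
  using upd_mem_image_iff[of "{\<gamma>}" k \<alpha> e e'] assms by auto

lemma upd_neq_zero_upd:
  assumes "\<alpha> \<in> cube_vertices k"
  shows "\<alpha>(k := e) \<noteq> (zero_vertex k)(k := e')" "(zero_vertex k)(k := e') \<noteq> \<alpha>(k := e)"
  by (metis assms upd_undefined_eq_zero_iff zero_vertex_upd_undefined)+

lemma basis_average_axis_lift:
  assumes "basis_average k c" "e \<in> {0, 1}"
  shows "basis_average (Suc k) (axis_lift k e c)"
  using assms(1)
proof induction
  case (basis B c)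
  note B = cube_basis_subset[OF basis(1)]
  show ?case
  proof (rule basis_average.basis[OF cube_basis.add_axis[OF basis(1) assms(2)]])
    fix \<beta> assume "\<beta> \<in> cube_vertices (Suc k)"
    then show "axis_lift k e c \<beta>
      = indicator (insert ((zero_vertex k)(k := 1)) ((\<lambda>\<beta>. \<beta>(k := e)) ` B)) \<beta>"
    proof (cases rule: cube_vertices_Suc_cases)
      case 1
      then show ?thesis by (simp add: axis_lift_def zero_vertex_upd_undefined del: fun_upd_upd)
    next
      case (2 \<alpha> e')
      then show ?thesis
        using upd_undefined_eq_zero_iff[OF 2(1)] upd_mem_image_iff[OF B 2(1)]
          upd_neq_zero_upd[OF 2(1)] cube_vertices_upd_undefined[OF 2(1)] basis(2)[OF 2(1)]
        by (auto simp: axis_lift_def indicator_def zero_vertex_upd_undefined simp del: fun_upd_upd)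
    qed
  qed
next
  case (mix c1 c2 u c)
  show ?case
  proof (rule basis_average.mix[OF mix.IH mix.hyps(3,4)])
    fix \<beta> assume "\<beta> \<in> cube_vertices (Suc k)"
    then show "axis_lift k e c \<beta> = u * axis_lift k e c1 \<beta> + (1 - u) * axis_lift k e c2 \<beta>"
    proof (cases rule: cube_vertices_Suc_cases)
      case 1
      then show ?thesis by (simp add: axis_lift_def zero_vertex_upd_undefined del: fun_upd_upd)
    next
      case (2 \<alpha> e')
      then show ?thesis
        using cube_vertices_upd_undefined[OF 2(1)] upd_undefined_eq_zero_iff[OF 2(1)]
           mix.hyps(5)[OF 2(1)]
        by (simp add: axis_lift_def del: fun_upd_upd)
    qed
  qed
qed

lemma basis_average_double_lift:
  assumes "basis_average k c" "e \<in> {0, 1}" "k > 0"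
  shows "basis_average (Suc k) (double_lift k e c)"
  using assms(1)
proof induction
  case (basis B c)
  note B = cube_basis_subset[OF basis(1)]
  let ?B = "\<lambda>\<gamma>. insert (\<gamma>(k := 1 - e)) ((\<lambda>\<beta>. \<beta>(k := e)) ` B)"
  have fin: "finite B" and card: "card B = k"
    using basis(1) cube_basis_finite cube_basis_card by auto
  have "B \<noteq> {}" using card assms(3) by auto
  \<comment> \<open>Average over the doubled element: each element of a \<open>k\<close>-element basis is doubled with probability \<open>1 / k\<close>.\<close>
  have "basis_average (Suc k) (\<lambda>\<alpha>. (\<Sum>\<gamma>\<in>B. indicator (?B \<gamma>) \<alpha>) / real (card B))"
    using basis(1) assms(2)
    by (intro basis_average_mean fin \<open>B \<noteq> {}\<close> basis_average.basis[OF cube_basis.double_vertex refl])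
  then show ?case
  proof (rule basis_average.mix[where u = 1, OF _ _])
    show "basis_average (Suc k) (\<lambda>\<alpha>. (\<Sum>\<gamma>\<in>B. indicator (?B \<gamma>) \<alpha>) / real (card B))" by fact
    fix \<beta> assume "\<beta> \<in> cube_vertices (Suc k)"
    then have "double_lift k e c \<beta> = (\<Sum>\<gamma>\<in>B. indicator (?B \<gamma>) \<beta>) / real (card B)"
    proof (cases rule: cube_vertices_Suc_cases)
      case 1
      have "indicator (?B \<gamma>) \<beta> = (0::real)" if "\<gamma> \<in> B" for \<gamma>
        using that B upd_neq_zero_upd(2)[of \<gamma> k 1] zero_upd_notin[OF B] by (auto simp: 1)
      then show ?thesis using 1 by (simp add: double_lift_def zero_vertex_upd_undefined del: fun_upd_upd)
    next
      case (2 \<alpha> e')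
      have lift: "double_lift k e c \<beta> = indicator B \<alpha> * (if e' = e then 1 else 1 / real k)"
        using cube_vertices_upd_undefined[OF 2(1)] upd_undefined_eq_zero_iff[OF 2(1)]
           basis(2)[OF 2(1)] by (simp add: double_lift_def 2 del: fun_upd_upd)
      have mem: "\<beta> \<in> ?B \<gamma> \<longleftrightarrow> (\<alpha> = \<gamma> \<and> e' \<noteq> e) \<or> (\<alpha> \<in> B \<and> e = e')" if "\<gamma> \<in> B" for \<gamma>
        using upd_mem_image_iff[OF B 2(1)] upd_eq_iff[of \<gamma> k \<alpha> e' "1 - e"] that B 2 assms(2)
        by auto
      show ?thesis
      proof (cases "e' = e")
        case True
        then have "(\<Sum>\<gamma>\<in>B. indicator (?B \<gamma>) \<beta>) = (\<Sum>\<gamma>\<in>B. indicator B \<alpha> :: real)"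
          using mem by (intro sum.cong) (auto simp: indicator_def)
        then show ?thesis using True lift card assms(3) by simp
      next
        case False
        then have "(\<Sum>\<gamma>\<in>B. indicator (?B \<gamma>) \<beta>) = (\<Sum>\<gamma>\<in>B. if \<alpha> = \<gamma> then 1 else 0 :: real)"
          using mem by (intro sum.cong) (auto simp: indicator_def)
        then show ?thesis using False lift card fin by (simp add: indicator_def)
      qed
    qed
    then show "double_lift k e c \<beta> = 1 * ((\<Sum>\<gamma>\<in>B. indicator (?B \<gamma>) \<beta>) / real (card B))
      + (1 - 1) * ((\<Sum>\<gamma>\<in>B. indicator (?B \<gamma>) \<beta>) / real (card B))" by simp
  qed auto
next
  case (mix c1 c2 u c)
  show ?case
  proof (rule basis_average.mix[OF mix.IH mix.hyps(3,4)])
    fix \<beta> assume "\<beta> \<in> cube_vertices (Suc k)"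
    then show "double_lift k e c \<beta> = u * double_lift k e c1 \<beta> + (1 - u) * double_lift k e c2 \<beta>"
    proof (cases rule: cube_vertices_Suc_cases)
      case 1
      then show ?thesis by (simp add: double_lift_def zero_vertex_upd_undefined del: fun_upd_upd)
    next
      case (2 \<alpha> e')
      then show ?thesis
        using cube_vertices_upd_undefined[OF 2(1)] upd_undefined_eq_zero_iff[OF 2(1)]
        by (simp add: double_lift_def mix.hyps(5)[OF 2(1)] add_divide_distrib del: fun_upd_upd)
    qed
  qed
qed

text \<open>By symmetry between the two levels, all lifted vertices receive equal probability from either construction; the
  only freedom is the probability \<open>p\<close> of adding the unit vector, which is also the probability that the unit vector is
  covered. It must be \<open>(k + 1) / (2\<^sup>k\<^sup>+\<^sup>1 - 1)\<close>, and the expected size \<open>k + 1\<close> of the basis then forces the same value on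
  the other \<open>2\<^sup>k\<^sup>+\<^sup>1 - 2\<close> vertices.\<close>

lemma basis_average_uniform:
  "\<exists>c. basis_average k c \<and> (\<forall>\<alpha>\<in>cube_vertices k. c \<alpha> = real k / (2 ^ k - 1))"
proof (induction k)
  case 0
  show ?case
    using basis_average.basis[OF cube_basis.empty, of "indicator {}"] by (auto simp: cube_vertices_0)
next
  case (Suc k)
  then obtain c where c: "basis_average k c" "\<And>\<alpha>. \<alpha> \<in> cube_vertices k \<Longrightarrow> c \<alpha> = real k / (2 ^ k - 1)"
    by blast
  define axis where "axis = (\<lambda>\<beta>. (axis_lift k 0 c \<beta> + axis_lift k 1 c \<beta>) / 2)"
  have axis: "basis_average (Suc k) axis"
    unfolding axis_def by (intro basis_average_midpoint basis_average_axis_lift c(1)) auto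
  \<comment> \<open>In dimension one the last unit vector is the only vertex, and there is no element to double.\<close>
  show ?case
  proof (cases "k = 0")
    case True
    have "axis \<beta> = real (Suc k) / (2 ^ Suc k - 1)" if "\<beta> \<in> cube_vertices (Suc k)" for \<beta>
      using that by (cases rule: cube_vertices_Suc_cases)
        (auto simp: axis_def axis_lift_def True cube_vertices_0 zero_vertex_upd_undefined simp del: fun_upd_upd)
    with axis show ?thesis by blast
  next
    case False
    define double where
      "double = (\<lambda>\<beta>. (double_lift k 0 c \<beta> + double_lift k 1 c \<beta>) / 2)"
    have double: "basis_average (Suc k) double"
      unfolding double_def using False
      by (intro basis_average_midpoint basis_average_double_lift c(1)) auto
    define p :: real where "p = (real k + 1) / (2 ^ Suc k - 1)"
    have "real k + 1 \<le> 2 ^ k" 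
      using Suc_leI[OF less_exp[of k]] by (metis of_nat_Suc of_nat_le_iff of_nat_numeral of_nat_power add.commute)
    then have k2: "(2::real) ^ k \<ge> 2" using False by (cases k) auto
    then have p: "0 \<le> p" "p \<le> 1"
      using \<open>real k + 1 \<le> 2 ^ k\<close> by (auto simp: p_def)
    define mixed where "mixed = (\<lambda>\<beta>. p * axis \<beta> + (1 - p) * double \<beta>)"
    have "basis_average (Suc k) mixed"
      by (rule basis_average.mix[OF axis double p]) (simp add: mixed_def)
    moreover have "mixed \<beta> = real (Suc k) / (2 ^ Suc k - 1)" if "\<beta> \<in> cube_vertices (Suc k)" for \<beta>
      using that
    proof (cases rule: cube_vertices_Suc_cases)
      case 1
      then show ?thesis
        by (simp add: mixed_def axis_def double_def axis_lift_def double_lift_def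
          zero_vertex_upd_undefined del: fun_upd_upd) (simp add: p_def)
    next
      case (2 \<alpha> e)
      have "axis \<beta> = c \<alpha> / 2" "double \<beta> = c \<alpha> * (1 + 1 / real k) / 2"
        using cube_vertices_upd_undefined[OF 2(1)] upd_undefined_eq_zero_iff[OF 2(1)] 2(2)
        by (auto simp: 2(3) axis_def double_def axis_lift_def double_lift_def ring_distribs
          simp del: fun_upd_upd)
      then have "mixed \<beta> = p * (c \<alpha> / 2) + (1 - p) * (c \<alpha> * (1 + 1 / real k) / 2)"
        by (simp only: mixed_def)
      also have "\<dots> = real (Suc k) / (2 ^ Suc k - 1)"
      proof -
        define m where "m = (2::real) ^ k"
        have m: "m - 1 \<noteq> 0" "2 * m - 1 \<noteq> 0" using k2 by (auto simp: m_def)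
        show ?thesis
          unfolding p_def c(2)[OF 2(1)] power_Suc m_def[symmetric]
          using m False by (simp add: divide_simps) (simp add: algebra_simps)
      qed
      finally show ?thesis .
    qed
    ultimately show ?thesis by blast
  qed
qed

section \<open>The integral inequality for the cubic convolution product\<close>

lemma measurable_cube_dot [measurable]:
  "(\<lambda>h. cube_dot k \<alpha> h :: 'a::euclidean_space) \<in> borel_measurable (PiM {..<k} (\<lambda>_. lborel))"
  unfolding cube_dot_def by measurable

lemma cube_dot_upd:
  "cube_dot (Suc k) (\<alpha>(k := e)) (h(k := t)) = cube_dot k \<alpha> h + e *\<^sub>R t"
  unfolding cube_dot_def by (simp add: sum.lessThan_Suc)

lemma cube_dot_zero_vertex: "cube_dot k (zero_vertex k) h = 0"
  unfolding cube_dot_def zero_vertex_def by simp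

lemma nn_integral_translate:
  fixes f :: "'a::euclidean_space \<Rightarrow> ennreal"
  assumes [measurable]: "f \<in> borel_measurable borel"
  shows "(\<integral>\<^sup>+x. f (x + c) \<partial>lborel) = (\<integral>\<^sup>+x. f x \<partial>lborel)"
proof -
  have "(\<integral>\<^sup>+x. f x \<partial>lborel) = (\<integral>\<^sup>+x. f x \<partial>distr lborel borel ((+) c))"
    by (simp add: lborel_distr_plus)
  also have "\<dots> = (\<integral>\<^sup>+x. f (c + x) \<partial>lborel)" by (rule nn_integral_distr) auto
  finally show ?thesis by (simp add: add.commute)
qed

lemma nn_integral_correlation:
  fixes a b :: "'a::euclidean_space \<Rightarrow> ennreal"
  assumes [measurable]: "a \<in> borel_measurable borel" "b \<in> borel_measurable borel"
  shows "(\<integral>\<^sup>+t. (\<integral>\<^sup>+x. a x * b (x + t) \<partial>lborel) \<partial>lborel)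
    = (\<integral>\<^sup>+x. a x \<partial>lborel) * (\<integral>\<^sup>+x. b x \<partial>lborel)"
proof -
  have "(\<integral>\<^sup>+t. (\<integral>\<^sup>+x. a x * b (x + t) \<partial>lborel) \<partial>lborel)
    = (\<integral>\<^sup>+x. (\<integral>\<^sup>+t. a x * b (t + x) \<partial>lborel) \<partial>lborel)"
    by (subst lborel_pair.Fubini') (auto simp: add.commute)
  also have "\<dots> = (\<integral>\<^sup>+x. a x * (\<integral>\<^sup>+t. b t \<partial>lborel) \<partial>lborel)"
    by (simp add: nn_integral_cmult nn_integral_translate)
  finally show ?thesis by (simp add: nn_integral_multc)
qed

lemma nn_integral_PiM_Suc:
  assumes "f \<in> borel_measurable (PiM {..<Suc k} (\<lambda>_. lborel :: 'a::euclidean_space measure))"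
  shows "(\<integral>\<^sup>+h. f h \<partial>PiM {..<Suc k} (\<lambda>_. lborel))
    = (\<integral>\<^sup>+t. (\<integral>\<^sup>+h. f (h(k := t)) \<partial>PiM {..<k} (\<lambda>_. lborel)) \<partial>lborel)"
proof -
  interpret product_sigma_finite "\<lambda>_::nat. lborel :: 'a measure" by standard
  show ?thesis
    using product_nn_integral_insert_rev[of "{..<k}" k f] assms by (simp add: lessThan_Suc)
qed

text \<open>The change of variables by a unimodular basis, obtained without determinants: fix the last coordinate \<open>t\<close>, apply the
  induction hypothesis to the functions translated by \<open>e *\<^sub>R t\<close>, and integrate over \<open>t\<close> last. For a doubled
  vertex, the two functions attached to it are multiplied into one function of the remaining variables, and
  integrating over \<open>t\<close> separates them again.\<close>

lemma nn_integral_cube_basis: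
  fixes G :: "(nat \<Rightarrow> real) \<Rightarrow> 'a::euclidean_space \<Rightarrow> ennreal"
  assumes "cube_basis k B" "\<And>\<beta>. \<beta> \<in> B \<Longrightarrow> G \<beta> \<in> borel_measurable borel"
  shows "(\<integral>\<^sup>+h. (\<Prod>\<beta>\<in>B. G \<beta> (cube_dot k \<beta> h)) \<partial>PiM {..<k} (\<lambda>_. lborel))
    = (\<Prod>\<beta>\<in>B. \<integral>\<^sup>+x. G \<beta> x \<partial>lborel)"
  using assms
proof (induction arbitrary: G rule: cube_basis.induct)
  case empty
  interpret product_sigma_finite "\<lambda>_::nat. lborel :: 'a measure" by standard
  show ?case by (simp add: nn_integral_empty space_PiM_empty)
next
  case (add_axis k B e)
  let ?z = "(zero_vertex k)(k := 1)" and ?M = "PiM {..<k} (\<lambda>_. lborel :: 'a measure)"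
  note sub = cube_basis_subset[OF add_axis.hyps(1)]
  note fin = cube_basis_finite[OF add_axis.hyps(1)]
  have meas [measurable]: "G ?z \<in> borel_measurable borel"
    "\<And>\<beta>. \<beta> \<in> B \<Longrightarrow> G (\<beta>(k := e)) \<in> borel_measurable borel"
    using add_axis.prems by auto
  have prod: "prod g (insert ?z ((\<lambda>\<beta>. \<beta>(k := e)) ` B)) = g ?z * (\<Prod>\<beta>\<in>B. g (\<beta>(k := e)))"
    for g :: "_ \<Rightarrow> ennreal"
    using fin zero_upd_notin[OF sub] inj_on_upd[OF sub]
    by (subst prod.insert) (auto simp: prod.reindex)
  have "(\<integral>\<^sup>+h. (\<Prod>\<beta>\<in>insert ?z ((\<lambda>\<beta>. \<beta>(k := e)) ` B). G \<beta> (cube_dot (Suc k) \<beta> h))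
      \<partial>PiM {..<Suc k} (\<lambda>_. lborel))
    = (\<integral>\<^sup>+t. (\<integral>\<^sup>+h. G ?z t * (\<Prod>\<beta>\<in>B. G (\<beta>(k := e)) (cube_dot k \<beta> h + e *\<^sub>R t)) \<partial>?M) \<partial>lborel)"
    unfolding prod by (subst nn_integral_PiM_Suc) (auto simp: cube_dot_upd cube_dot_zero_vertex)
  also have "\<dots> = (\<integral>\<^sup>+t. G ?z t * (\<Prod>\<beta>\<in>B. \<integral>\<^sup>+x. G (\<beta>(k := e)) x \<partial>lborel) \<partial>lborel)"
  proof (rule nn_integral_cong)
    fix t :: 'a
    have "(\<integral>\<^sup>+h. (\<Prod>\<beta>\<in>B. G (\<beta>(k := e)) (cube_dot k \<beta> h + e *\<^sub>R t)) \<partial>?M)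
      = (\<Prod>\<beta>\<in>B. \<integral>\<^sup>+x. G (\<beta>(k := e)) (x + e *\<^sub>R t) \<partial>lborel)"
      by (rule add_axis.IH[of "\<lambda>\<beta> x. G (\<beta>(k := e)) (x + e *\<^sub>R t)"]) measurable
    also have "\<dots> = (\<Prod>\<beta>\<in>B. \<integral>\<^sup>+x. G (\<beta>(k := e)) x \<partial>lborel)"
      by (intro prod.cong refl nn_integral_translate meas)
    finally show "(\<integral>\<^sup>+h. G ?z t * (\<Prod>\<beta>\<in>B. G (\<beta>(k := e)) (cube_dot k \<beta> h + e *\<^sub>R t)) \<partial>?M)
      = G ?z t * (\<Prod>\<beta>\<in>B. \<integral>\<^sup>+x. G (\<beta>(k := e)) x \<partial>lborel)"
      by (subst nn_integral_cmult) (auto intro!: borel_measurable_prod)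
  qed
  also have "\<dots> = (\<Prod>\<beta>\<in>insert ?z ((\<lambda>\<beta>. \<beta>(k := e)) ` B). \<integral>\<^sup>+x. G \<beta> x \<partial>lborel)"
    unfolding prod by (rule nn_integral_multc) measurable
  finally show ?case .
next
  case (double_vertex k B e \<gamma>)
  let ?z = "\<gamma>(k := 1 - e)" and ?M = "PiM {..<k} (\<lambda>_. lborel :: 'a measure)"
  note sub = cube_basis_subset[OF double_vertex.hyps(1)]
  note fin = cube_basis_finite[OF double_vertex.hyps(1)]
  have meas [measurable]: "G ?z \<in> borel_measurable borel"
    "\<And>\<beta>. \<beta> \<in> B \<Longrightarrow> G (\<beta>(k := e)) \<in> borel_measurable borel"
    "G (\<gamma>(k := e)) \<in> borel_measurable borel"
    using double_vertex.prems double_vertex.hyps(3) by auto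
  have prod: "prod g (insert ?z ((\<lambda>\<beta>. \<beta>(k := e)) ` B)) = g ?z * (\<Prod>\<beta>\<in>B. g (\<beta>(k := e)))"
    for g :: "_ \<Rightarrow> ennreal"
    using fin double_upd_notin[OF double_vertex.hyps(2), of \<gamma> k B] inj_on_upd[OF sub]
    by (subst prod.insert) (simp_all add: prod.reindex)
  have split: "prod g B = g \<gamma> * prod g (B - {\<gamma>})" for g :: "_ \<Rightarrow> ennreal"
    using fin double_vertex.hyps(3) by (rule prod.remove)
  define P where "P = (\<Prod>\<beta>\<in>B - {\<gamma>}. \<integral>\<^sup>+x. G (\<beta>(k := e)) x \<partial>lborel)"
  have "(\<integral>\<^sup>+h. (\<Prod>\<beta>\<in>insert ?z ((\<lambda>\<beta>. \<beta>(k := e)) ` B). G \<beta> (cube_dot (Suc k) \<beta> h))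
      \<partial>PiM {..<Suc k} (\<lambda>_. lborel))
    = (\<integral>\<^sup>+t. (\<integral>\<^sup>+h. G ?z (cube_dot k \<gamma> h + (1 - e) *\<^sub>R t) *
        (\<Prod>\<beta>\<in>B. G (\<beta>(k := e)) (cube_dot k \<beta> h + e *\<^sub>R t)) \<partial>?M) \<partial>lborel)"
    unfolding prod by (subst nn_integral_PiM_Suc) (auto simp: cube_dot_upd)
  also have "\<dots> = (\<integral>\<^sup>+t. (\<integral>\<^sup>+x. G (\<gamma>(k := e)) (x + e *\<^sub>R t) * G ?z (x + (1 - e) *\<^sub>R t) \<partial>lborel) * P
      \<partial>lborel)"
  proof (rule nn_integral_cong)
    fix t :: 'a
    define H where "H = (\<lambda>\<beta> x. G (\<beta>(k := e)) (x + e *\<^sub>R t) *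
      (if \<beta> = \<gamma> then G ?z (x + (1 - e) *\<^sub>R t) else 1))"
    have H: "H \<beta> \<in> borel_measurable borel" if "\<beta> \<in> B" for \<beta>
      using that unfolding H_def by measurable
    have "G ?z (cube_dot k \<gamma> h + (1 - e) *\<^sub>R t) *
        (\<Prod>\<beta>\<in>B. G (\<beta>(k := e)) (cube_dot k \<beta> h + e *\<^sub>R t)) = (\<Prod>\<beta>\<in>B. H \<beta> (cube_dot k \<beta> h))" for h
      unfolding split H_def by (simp add: mult_ac)
    then have "(\<integral>\<^sup>+h. G ?z (cube_dot k \<gamma> h + (1 - e) *\<^sub>R t) *
        (\<Prod>\<beta>\<in>B. G (\<beta>(k := e)) (cube_dot k \<beta> h + e *\<^sub>R t)) \<partial>?M)
      = (\<Prod>\<beta>\<in>B. \<integral>\<^sup>+x. H \<beta> x \<partial>lborel)"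
      using double_vertex.IH[of H] H by simp
    also have "\<dots> = (\<integral>\<^sup>+x. G (\<gamma>(k := e)) (x + e *\<^sub>R t) * G ?z (x + (1 - e) *\<^sub>R t) \<partial>lborel) * P"
      unfolding split P_def H_def by (auto intro!: arg_cong2[where f = "(*)"] prod.cong nn_integral_translate)
    finally show "(\<integral>\<^sup>+h. G ?z (cube_dot k \<gamma> h + (1 - e) *\<^sub>R t) *
        (\<Prod>\<beta>\<in>B. G (\<beta>(k := e)) (cube_dot k \<beta> h + e *\<^sub>R t)) \<partial>?M)
      = (\<integral>\<^sup>+x. G (\<gamma>(k := e)) (x + e *\<^sub>R t) * G ?z (x + (1 - e) *\<^sub>R t) \<partial>lborel) * P" .
  qed
  also have "\<dots> = (\<integral>\<^sup>+t. (\<integral>\<^sup>+x. G (\<gamma>(k := e)) (x + e *\<^sub>R t) * G ?z (x + (1 - e) *\<^sub>R t) \<partial>lborel)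
      \<partial>lborel) * P"
    by (rule nn_integral_multc) measurable
  also have "(\<integral>\<^sup>+t. (\<integral>\<^sup>+x. G (\<gamma>(k := e)) (x + e *\<^sub>R t) * G ?z (x + (1 - e) *\<^sub>R t) \<partial>lborel) \<partial>lborel)
      = (\<integral>\<^sup>+x. G (\<gamma>(k := e)) x \<partial>lborel) * (\<integral>\<^sup>+x. G ?z x \<partial>lborel)"
    using double_vertex.hyps(2) nn_integral_correlation[OF meas(3,1)]
      nn_integral_correlation[OF meas(1,3)]
    by (auto simp: mult.commute)
  finally show ?case unfolding prod split P_def by (simp add: mult_ac)
qed

lemma weighted_geometric_mean_le:
  fixes x y u :: real
  assumes "0 \<le> x" "0 \<le> y" "0 \<le> u" "u \<le> 1"
  shows "x powr u * y powr (1 - u) \<le> u * x + (1 - u) * y"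
proof (cases "x = 0 \<or> y = 0")
  case False
  then show ?thesis using Youngs_inequality_0[of u "1 - u" x y] assms by simp
qed (use assms in auto)

text \<open>For the indicator of a basis this is the change of variables, and the weighted inequality of arithmetic and geometric
  means shows that the admissible exponents form a convex set. With the convention \<open>0 powr 0 = 0\<close>, a factor with exponent zero is
  at most one, which suffices.\<close>

lemma nn_integral_basis_average_le_1:
  fixes F :: "(nat \<Rightarrow> real) \<Rightarrow> 'a::euclidean_space \<Rightarrow> real"
  assumes "basis_average k c"
    and [measurable]: "\<And>\<alpha>. \<alpha> \<in> cube_vertices k \<Longrightarrow> F \<alpha> \<in> borel_measurable borel"
    and nonneg: "\<And>\<alpha> x. \<alpha> \<in> cube_vertices k \<Longrightarrow> F \<alpha> x \<ge> 0"
    and le_1: "\<And>\<alpha>. \<alpha> \<in> cube_vertices k \<Longrightarrow> (\<integral>\<^sup>+x. ennreal (F \<alpha> x) \<partial>lborel) \<le> 1"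
  shows "(\<integral>\<^sup>+h. ennreal (\<Prod>\<alpha>\<in>cube_vertices k. F \<alpha> (cube_dot k \<alpha> h) powr c \<alpha>)
    \<partial>PiM {..<k} (\<lambda>_. lborel)) \<le> 1"
  using assms(1)
proof induction
  case (basis B c)
  let ?M = "PiM {..<k} (\<lambda>_. lborel :: 'a measure)"
  note sub = cube_basis_subset[OF basis(1)]
  have "(\<Prod>\<alpha>\<in>cube_vertices k. F \<alpha> (cube_dot k \<alpha> h) powr c \<alpha>)
    \<le> (\<Prod>\<alpha>\<in>B. F \<alpha> (cube_dot k \<alpha> h))" for h
  proof -
    have "(\<Prod>\<alpha>\<in>cube_vertices k. F \<alpha> (cube_dot k \<alpha> h) powr c \<alpha>)
      \<le> (\<Prod>\<alpha>\<in>cube_vertices k. if \<alpha> \<in> B then F \<alpha> (cube_dot k \<alpha> h) else 1)"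
      by (intro prod_mono) (auto simp: basis(2) nonneg)
    also have "\<dots> = (\<Prod>\<alpha>\<in>B. F \<alpha> (cube_dot k \<alpha> h))"
      using sub by (subst prod.inter_restrict[OF finite_cube_vertices, symmetric]) (simp add: Int_absorb1)
    finally show ?thesis .
  qed
  then have "(\<integral>\<^sup>+h. ennreal (\<Prod>\<alpha>\<in>cube_vertices k. F \<alpha> (cube_dot k \<alpha> h) powr c \<alpha>) \<partial>?M)
    \<le> (\<integral>\<^sup>+h. (\<Prod>\<alpha>\<in>B. ennreal (F \<alpha> (cube_dot k \<alpha> h))) \<partial>?M)"
    using sub nonneg by (intro nn_integral_mono) (subst prod_ennreal, auto intro: ennreal_leI)
  also have "\<dots> = (\<Prod>\<alpha>\<in>B. \<integral>\<^sup>+x. ennreal (F \<alpha> x) \<partial>lborel)"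
    using sub by (intro nn_integral_cube_basis basis(1)) auto
  also have "\<dots> \<le> 1" using sub le_1 by (intro prod_le_1) auto
  finally show ?case .
next
  case (mix c1 c2 u c)
  let ?M = "PiM {..<k} (\<lambda>_. lborel :: 'a measure)"
  let ?P = "\<lambda>c h. \<Prod>\<alpha>\<in>cube_vertices k. F \<alpha> (cube_dot k \<alpha> h) powr c \<alpha>"
  have P_nonneg: "?P c h \<ge> 0" for c h by (intro prod_nonneg) auto
  have "?P c h \<le> u * ?P c1 h + (1 - u) * ?P c2 h" for h
  proof -
    have "?P c h = ?P c1 h powr u * ?P c2 h powr (1 - u)"
      by (simp add: mix.hyps(5) powr_add powr_powr prod.distrib prod_powr_distrib
        mult.commute[of u] mult.commute[of "1 - u"])
    also have "\<dots> \<le> u * ?P c1 h + (1 - u) * ?P c2 h"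
      by (intro weighted_geometric_mean_le P_nonneg mix.hyps)
    finally show ?thesis .
  qed
  then have "(\<integral>\<^sup>+h. ennreal (?P c h) \<partial>?M)
    \<le> (\<integral>\<^sup>+h. ennreal u * ennreal (?P c1 h) + ennreal (1 - u) * ennreal (?P c2 h) \<partial>?M)"
    using P_nonneg mix.hyps by (intro nn_integral_mono) (simp flip: ennreal_mult' ennreal_plus)
  also have "\<dots> = ennreal u * (\<integral>\<^sup>+h. ennreal (?P c1 h) \<partial>?M)
      + ennreal (1 - u) * (\<integral>\<^sup>+h. ennreal (?P c2 h) \<partial>?M)"
    by (subst nn_integral_add) (auto simp: nn_integral_cmult)
  also have "\<dots> \<le> ennreal u * 1 + ennreal (1 - u) * 1"
    by (intro add_mono mult_left_mono mix.IH) auto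
  also have "\<dots> = 1" using mix.hyps by (simp flip: ennreal_plus)
  finally show ?case .
qed

text \<open>The homogeneous form. The bounds \<open>m\<close> are kept positive so that normalisation by division is possible.\<close>

lemma nn_integral_basis_average_le:
  fixes F :: "(nat \<Rightarrow> real) \<Rightarrow> 'a::euclidean_space \<Rightarrow> real"
  assumes "basis_average k c"
    and [measurable]: "\<And>\<alpha>. \<alpha> \<in> cube_vertices k \<Longrightarrow> F \<alpha> \<in> borel_measurable borel"
    and nonneg: "\<And>\<alpha> x. \<alpha> \<in> cube_vertices k \<Longrightarrow> F \<alpha> x \<ge> 0"
    and pos: "\<And>\<alpha>. \<alpha> \<in> cube_vertices k \<Longrightarrow> m \<alpha> > 0"
    and le: "\<And>\<alpha>. \<alpha> \<in> cube_vertices k \<Longrightarrow> (\<integral>\<^sup>+x. ennreal (F \<alpha> x) \<partial>lborel) \<le> ennreal (m \<alpha>)"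
  shows "(\<integral>\<^sup>+h. ennreal (\<Prod>\<alpha>\<in>cube_vertices k. F \<alpha> (cube_dot k \<alpha> h) powr c \<alpha>)
    \<partial>PiM {..<k} (\<lambda>_. lborel)) \<le> ennreal (\<Prod>\<alpha>\<in>cube_vertices k. m \<alpha> powr c \<alpha>)"
proof -
  let ?V = "cube_vertices k" and ?M = "PiM {..<k} (\<lambda>_. lborel :: 'a measure)"
  define C where "C = (\<Prod>\<alpha>\<in>?V. m \<alpha> powr c \<alpha>)"
  have "C \<ge> 0" unfolding C_def by (intro prod_nonneg) auto
  have "(\<integral>\<^sup>+x. ennreal (F \<alpha> x / m \<alpha>) \<partial>lborel) \<le> 1" if \<alpha>: "\<alpha> \<in> ?V" for \<alpha>
  proof -
    have "(\<integral>\<^sup>+x. ennreal (F \<alpha> x / m \<alpha>) \<partial>lborel) = (\<integral>\<^sup>+x. ennreal (1 / m \<alpha>) * ennreal (F \<alpha> x) \<partial>lborel)"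
      using pos[OF \<alpha>] nonneg[OF \<alpha>] by (intro nn_integral_cong) (simp flip: ennreal_mult)
    also have "\<dots> = ennreal (1 / m \<alpha>) * (\<integral>\<^sup>+x. ennreal (F \<alpha> x) \<partial>lborel)"
      using \<alpha> by (intro nn_integral_cmult) measurable
    also have "\<dots> \<le> ennreal (1 / m \<alpha>) * ennreal (m \<alpha>)"
      by (intro mult_left_mono le \<alpha>) auto
    also have "\<dots> = 1" using pos[OF \<alpha>] by (simp flip: ennreal_mult)
    finally show ?thesis .
  qed
  then have le_1: "(\<integral>\<^sup>+h. ennreal (\<Prod>\<alpha>\<in>?V. (F \<alpha> (cube_dot k \<alpha> h) / m \<alpha>) powr c \<alpha>) \<partial>?M) \<le> 1"
    using pos nonneg
    by (intro nn_integral_basis_average_le_1[OF assms(1), of "\<lambda>\<alpha> x. F \<alpha> x / m \<alpha>"])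
      (auto intro!: divide_nonneg_pos)
  have eq: "(\<Prod>\<alpha>\<in>?V. F \<alpha> (cube_dot k \<alpha> h) powr c \<alpha>)
      = C * (\<Prod>\<alpha>\<in>?V. (F \<alpha> (cube_dot k \<alpha> h) / m \<alpha>) powr c \<alpha>)" for h
    unfolding C_def prod.distrib[symmetric]
    by (intro prod.cong refl) (use pos in \<open>force simp: powr_mult[symmetric]\<close>)
  have "(\<integral>\<^sup>+h. ennreal (\<Prod>\<alpha>\<in>?V. F \<alpha> (cube_dot k \<alpha> h) powr c \<alpha>) \<partial>?M)
    = ennreal C * (\<integral>\<^sup>+h. ennreal (\<Prod>\<alpha>\<in>?V. (F \<alpha> (cube_dot k \<alpha> h) / m \<alpha>) powr c \<alpha>) \<partial>?M)"
    unfolding eq using \<open>C \<ge> 0\<close> by (subst nn_integral_cmult[symmetric]) (auto simp: ennreal_mult')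
  also have "\<dots> \<le> ennreal C * 1" by (intro mult_left_mono le_1) auto
  finally show ?thesis by (simp add: C_def)
qed

lemma q_exp_ge_1:
  assumes "k \<ge> 1"
  shows "q_exp k \<ge> 1"
proof -
  have "real k + 1 \<le> 2 ^ k"
    using Suc_leI[OF less_exp[of k]]
    by (metis of_nat_Suc of_nat_le_iff of_nat_numeral of_nat_power add.commute)
  then show ?thesis using assms by (simp add: q_exp_def field_simps)
qed

lemma Lq_norm_nonneg: "Lq_norm q f \<ge> 0"
  unfolding Lq_norm_def by simp

lemma Lq_measurable [measurable_dest]: "f \<in> Lq q \<Longrightarrow> f \<in> borel_measurable borel"
  unfolding Lq_def by simp

lemma Lq_integrable: "f \<in> Lq q \<Longrightarrow> integrable lborel (\<lambda>x. \<bar>f x\<bar> powr q)"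
  unfolding Lq_def by simp

lemma LqI:
  "f \<in> borel_measurable borel \<Longrightarrow> integrable lborel (\<lambda>x. \<bar>f x\<bar> powr q) \<Longrightarrow> f \<in> Lq q"
  unfolding Lq_def by simp

lemma nn_integral_Lq:
  "f \<in> Lq q \<Longrightarrow> (\<integral>\<^sup>+x. ennreal (\<bar>f x\<bar> powr q) \<partial>lborel) = ennreal (LINT x|lborel. \<bar>f x\<bar> powr q)"
  by (intro nn_integral_eq_integral Lq_integrable) auto

lemma Lq_cmult: "f \<in> Lq q \<Longrightarrow> (\<lambda>x. c * f x) \<in> Lq q"
  by (intro LqI) (auto simp: abs_mult powr_mult intro!: integrable_mult_right dest: Lq_integrable)

lemma Lq_norm_cmult:
  assumes "q > 0"
  shows "Lq_norm q (\<lambda>x. c * f x) = \<bar>c\<bar> * Lq_norm q f"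
  using assms unfolding Lq_norm_def by (simp add: abs_mult powr_mult powr_powr)

lemma abs_diff_powr_le:
  fixes a b :: real
  assumes "q \<ge> 0"
  shows "\<bar>a - b\<bar> powr q \<le> 2 powr q * (\<bar>a\<bar> powr q + \<bar>b\<bar> powr q)"
proof -
  have "\<bar>a - b\<bar> powr q \<le> (2 * max \<bar>a\<bar> \<bar>b\<bar>) powr q"
    using assms by (intro powr_mono2) auto
  also have "\<dots> = 2 powr q * max \<bar>a\<bar> \<bar>b\<bar> powr q" by (simp add: powr_mult)
  also have "\<dots> \<le> 2 powr q * (\<bar>a\<bar> powr q + \<bar>b\<bar> powr q)"
    by (intro mult_left_mono) (auto simp: max_def)
  finally show ?thesis .
qed

lemma Lq_diff:
  assumes "f \<in> Lq q" "g \<in> Lq q" "q \<ge> 0"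
  shows "(\<lambda>x. f x - g x) \<in> Lq q"
proof (rule LqI)
  show "(\<lambda>x. f x - g x) \<in> borel_measurable borel" using assms(1,2) by measurable
  show "integrable lborel (\<lambda>x. \<bar>f x - g x\<bar> powr q)"
  proof (rule Bochner_Integration.integrable_bound)
    show "integrable lborel (\<lambda>x. 2 powr q * (\<bar>f x\<bar> powr q + \<bar>g x\<bar> powr q))"
      using assms by (intro integrable_mult_right Bochner_Integration.integrable_add Lq_integrable)
    show "(\<lambda>x. \<bar>f x - g x\<bar> powr q) \<in> borel_measurable lborel" using assms(1,2) by measurable
    show "AE x in lborel. norm (\<bar>f x - g x\<bar> powr q) \<le> norm (2 powr q * (\<bar>f x\<bar> powr q + \<bar>g x\<bar> powr q))"
      using abs_diff_powr_le[OF assms(3)] by (intro AE_I2) simp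
  qed
qed

text \<open>Apply \<open>nn_integral_basis_average_le\<close> to \<open>\<bar>f\<^sub>\<alpha>(x + y)\<bar>\<^sup>q\<close> with the uniform exponent \<open>1 / q\<close>. Some of the functions may vanish almost everywhere,
  so the integrals are first enlarged by \<open>1 / (n + 1)\<close> and then \<open>n\<close> tends to infinity.\<close>

lemma nn_integral_cubic_le:
  fixes f :: "(nat \<Rightarrow> real) \<Rightarrow> 'a::euclidean_space \<Rightarrow> real"
  assumes "k \<ge> 1" and f: "\<And>\<alpha>. \<alpha> \<in> cube_vertices k \<Longrightarrow> f \<alpha> \<in> Lq (q_exp k)"
  shows "(\<integral>\<^sup>+h. ennreal (\<Prod>\<alpha>\<in>cube_vertices k. \<bar>f \<alpha> (x + cube_dot k \<alpha> h)\<bar>)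
    \<partial>PiM {..<k} (\<lambda>_. lborel)) \<le> ennreal (\<Prod>\<alpha>\<in>cube_vertices k. Lq_norm (q_exp k) (f \<alpha>))"
proof -
  let ?V = "cube_vertices k" and ?M = "PiM {..<k} (\<lambda>_. lborel :: 'a measure)"
  define q where "q = q_exp k"
  have q: "q \<ge> 1" using q_exp_ge_1[OF assms(1)] by (simp add: q_def)
  define I where "I = (\<lambda>\<alpha>. LINT y|lborel. \<bar>f \<alpha> y\<bar> powr q)"
  have I: "I \<alpha> \<ge> 0" for \<alpha> unfolding I_def by simp
  obtain c where c: "basis_average k c" "\<And>\<alpha>. \<alpha> \<in> ?V \<Longrightarrow> c \<alpha> = real k / (2 ^ k - 1)"
    using basis_average_uniform[of k] by blast
  have c': "c \<alpha> = 1 / q" if "\<alpha> \<in> ?V" for \<alpha> using c(2)[OF that] by (simp add: q_def q_exp_def)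
  define F where "F = (\<lambda>\<alpha> y. \<bar>f \<alpha> (x + y)\<bar> powr q)"
  have F_int: "(\<integral>\<^sup>+y. ennreal (F \<alpha> y) \<partial>lborel) = ennreal (I \<alpha>)" if "\<alpha> \<in> ?V" for \<alpha>
  proof -
    have [measurable]: "f \<alpha> \<in> borel_measurable borel" using f[OF that] by measurable
    have "(\<integral>\<^sup>+y. ennreal (F \<alpha> y) \<partial>lborel) = (\<integral>\<^sup>+y. ennreal (\<bar>f \<alpha> y\<bar> powr q) \<partial>lborel)"
      using nn_integral_translate[of "\<lambda>y. ennreal (\<bar>f \<alpha> y\<bar> powr q)" x]
      by (simp add: F_def add.commute)
    then show ?thesis using nn_integral_Lq[OF f[OF that]] by (simp add: I_def q_def)
  qed
  have F_meas: "F \<alpha> \<in> borel_measurable borel" if "\<alpha> \<in> ?V" for \<alpha>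
    using f[OF that] unfolding F_def by measurable
  have F_powr: "(\<Prod>\<alpha>\<in>?V. F \<alpha> (cube_dot k \<alpha> h) powr c \<alpha>) = (\<Prod>\<alpha>\<in>?V. \<bar>f \<alpha> (x + cube_dot k \<alpha> h)\<bar>)" for h
    by (intro prod.cong refl) (use q in \<open>simp add: F_def c' powr_powr\<close>)
  have "(\<integral>\<^sup>+h. ennreal (\<Prod>\<alpha>\<in>?V. \<bar>f \<alpha> (x + cube_dot k \<alpha> h)\<bar>) \<partial>?M)
    \<le> ennreal (\<Prod>\<alpha>\<in>?V. (I \<alpha> + 1 / real (Suc n)) powr (1 / q))" for n
  proof -
    have "(\<integral>\<^sup>+h. ennreal (\<Prod>\<alpha>\<in>?V. F \<alpha> (cube_dot k \<alpha> h) powr c \<alpha>) \<partial>?M)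
      \<le> ennreal (\<Prod>\<alpha>\<in>?V. (I \<alpha> + 1 / real (Suc n)) powr c \<alpha>)"
    proof (rule nn_integral_basis_average_le[OF c(1) F_meas])
      show "F \<alpha> y \<ge> 0" for \<alpha> y by (simp add: F_def)
      show "I \<alpha> + 1 / real (Suc n) > 0" for \<alpha> using I by (simp add: add_nonneg_pos)
      show "(\<integral>\<^sup>+y. ennreal (F \<alpha> y) \<partial>lborel) \<le> ennreal (I \<alpha> + 1 / real (Suc n))" if "\<alpha> \<in> ?V" for \<alpha>
        unfolding F_int[OF that] by (intro ennreal_leI) simp
    qed
    then show ?thesis unfolding F_powr by (simp add: c')
  qed
  moreover have "(\<lambda>n. ennreal (\<Prod>\<alpha>\<in>?V. (I \<alpha> + 1 / real (Suc n)) powr (1 / q)))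
    \<longlonglongrightarrow> ennreal (\<Prod>\<alpha>\<in>?V. (I \<alpha> + 0) powr (1 / q))"
    using q I by (intro tendsto_ennrealI tendsto_prod tendsto_powr2 tendsto_add tendsto_const
      LIMSEQ_Suc[OF lim_1_over_n] always_eventually allI add_nonneg_nonneg) auto
  ultimately have "(\<integral>\<^sup>+h. ennreal (\<Prod>\<alpha>\<in>?V. \<bar>f \<alpha> (x + cube_dot k \<alpha> h)\<bar>) \<partial>?M)
    \<le> ennreal (\<Prod>\<alpha>\<in>?V. (I \<alpha> + 0) powr (1 / q))"
    by (intro LIMSEQ_le_const) auto
  then show ?thesis by (simp add: I_def Lq_norm_def q_def)
qed

lemma measurable_cubic_integrand:
  fixes f :: "(nat \<Rightarrow> real) \<Rightarrow> 'a::euclidean_space \<Rightarrow> real"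
  assumes "\<And>\<alpha>. \<alpha> \<in> cube_vertices k \<Longrightarrow> f \<alpha> \<in> borel_measurable borel"
  shows "(\<lambda>h. \<Prod>\<alpha>\<in>cube_vertices k. f \<alpha> (x + cube_dot k \<alpha> h))
    \<in> borel_measurable (PiM {..<k} (\<lambda>_. lborel))"
  using assms by measurable

lemma integrable_cubic:
  fixes f :: "(nat \<Rightarrow> real) \<Rightarrow> 'a::euclidean_space \<Rightarrow> real"
  assumes "k \<ge> 1" and f: "\<And>\<alpha>. \<alpha> \<in> cube_vertices k \<Longrightarrow> f \<alpha> \<in> Lq (q_exp k)"
  shows "integrable (PiM {..<k} (\<lambda>_. lborel)) (\<lambda>h. \<Prod>\<alpha>\<in>cube_vertices k. f \<alpha> (x + cube_dot k \<alpha> h))"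
proof (rule integrableI_bounded)
  show "(\<lambda>h. \<Prod>\<alpha>\<in>cube_vertices k. f \<alpha> (x + cube_dot k \<alpha> h))
    \<in> borel_measurable (PiM {..<k} (\<lambda>_. lborel))"
    using f by (intro measurable_cubic_integrand Lq_measurable)
  show "(\<integral>\<^sup>+h. ennreal (norm (\<Prod>\<alpha>\<in>cube_vertices k. f \<alpha> (x + cube_dot k \<alpha> h)))
    \<partial>PiM {..<k} (\<lambda>_. lborel)) < \<infinity>"
    by (simp add: abs_prod order_le_less_trans[OF nn_integral_cubic_le[where f = f, OF assms]])
qed

lemma abs_cubic_conv_le:
  fixes f :: "(nat \<Rightarrow> real) \<Rightarrow> 'a::euclidean_space \<Rightarrow> real"
  assumes "k \<ge> 1" and f: "\<And>\<alpha>. \<alpha> \<in> cube_vertices k \<Longrightarrow> f \<alpha> \<in> Lq (q_exp k)"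
  shows "\<bar>cubic_conv k f x\<bar> \<le> (\<Prod>\<alpha>\<in>cube_vertices k. Lq_norm (q_exp k) (f \<alpha>))"
proof -
  let ?M = "PiM {..<k} (\<lambda>_. lborel :: 'a measure)"
  let ?p = "\<lambda>h. \<Prod>\<alpha>\<in>cube_vertices k. f \<alpha> (x + cube_dot k \<alpha> h)"
  have "ennreal \<bar>cubic_conv k f x\<bar> \<le> (\<integral>\<^sup>+h. ennreal (norm (?p h)) \<partial>?M)"
    unfolding cubic_conv_def using integral_norm_bound_ennreal[OF integrable_cubic[where f = f, OF assms]] by simp
  also have "\<dots> \<le> ennreal (\<Prod>\<alpha>\<in>cube_vertices k. Lq_norm (q_exp k) (f \<alpha>))"
    using nn_integral_cubic_le[where f = f, OF assms] by (simp add: abs_prod)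
  finally show ?thesis by (simp add: ennreal_le_iff prod_nonneg Lq_norm_nonneg)
qed

text \<open>Expand the product of the functions \<open>g\<^sub>\<alpha> = f\<^sub>\<alpha> + (g\<^sub>\<alpha> - f\<^sub>\<alpha>)\<close> into a sum over sets \<open>X\<close> of vertices, bound each term by the
  product of norms, and fold the norms back. This form avoids any triangle inequality for \<open>Lq_norm\<close>.\<close>

lemma cubic_conv_diff_le:
  fixes f g :: "(nat \<Rightarrow> real) \<Rightarrow> 'a::euclidean_space \<Rightarrow> real"
  assumes "k \<ge> 1" and f: "\<And>\<alpha>. \<alpha> \<in> cube_vertices k \<Longrightarrow> f \<alpha> \<in> Lq (q_exp k)"
    and g: "\<And>\<alpha>. \<alpha> \<in> cube_vertices k \<Longrightarrow> g \<alpha> \<in> Lq (q_exp k)"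
  shows "\<bar>cubic_conv k g x - cubic_conv k f x\<bar>
    \<le> (\<Prod>\<alpha>\<in>cube_vertices k. Lq_norm (q_exp k) (f \<alpha>) + Lq_norm (q_exp k) (\<lambda>y. g \<alpha> y - f \<alpha> y))
      - (\<Prod>\<alpha>\<in>cube_vertices k. Lq_norm (q_exp k) (f \<alpha>))"
proof -
  let ?V = "cube_vertices k"
  let ?e = "\<lambda>\<alpha> y. g \<alpha> y - f \<alpha> y"
  let ?w = "\<lambda>X \<alpha>. if \<alpha> \<in> X then f \<alpha> else ?e \<alpha>"
  let ?N = "Lq_norm (q_exp k)"
  have q: "q_exp k \<ge> 0" using q_exp_ge_1[OF assms(1)] by simp
  have w: "?w X \<alpha> \<in> Lq (q_exp k)" if "\<alpha> \<in> ?V" for X \<alpha>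
    using that f g q by (auto intro: Lq_diff)
  have expand: "(\<Prod>\<alpha>\<in>?V. a \<alpha> + b \<alpha>) = (\<Sum>X\<in>Pow ?V. \<Prod>\<alpha>\<in>?V. if \<alpha> \<in> X then a \<alpha> else b \<alpha>)"
    for a b :: "(nat \<Rightarrow> real) \<Rightarrow> real"
    unfolding prod_add[OF finite_cube_vertices]
    by (intro sum.cong refl) (auto simp: prod.If_cases finite_cube_vertices Int_absorb1 Diff_eq
      intro!: arg_cong2[where f = "(*)"] prod.cong)
  have "cubic_conv k g x = (\<Sum>X\<in>Pow ?V. cubic_conv k (?w X) x)"
  proof -
    have "(\<Prod>\<alpha>\<in>?V. g \<alpha> (x + cube_dot k \<alpha> h)) = (\<Sum>X\<in>Pow ?V. \<Prod>\<alpha>\<in>?V. ?w X \<alpha> (x + cube_dot k \<alpha> h))" for h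
      using expand[of "\<lambda>\<alpha>. f \<alpha> (x + cube_dot k \<alpha> h)" "\<lambda>\<alpha>. ?e \<alpha> (x + cube_dot k \<alpha> h)"]
      by (simp add: if_distrib[of "\<lambda>u. u _"] cong: if_cong)
    then show ?thesis
      unfolding cubic_conv_def
      by (simp add: Bochner_Integration.integral_sum integrable_cubic[OF assms(1) w])
  qed
  moreover have "cubic_conv k (?w ?V) x = cubic_conv k f x"
    unfolding cubic_conv_def by (simp cong: prod.cong)
  ultimately have "cubic_conv k g x - cubic_conv k f x = (\<Sum>X\<in>Pow ?V - {?V}. cubic_conv k (?w X) x)"
    by (simp add: sum_diff1 finite_cube_vertices)
  also have "\<bar>\<dots>\<bar> \<le> (\<Sum>X\<in>Pow ?V - {?V}. \<Prod>\<alpha>\<in>?V. ?N (?w X \<alpha>))"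
    by (intro order_trans[OF sum_abs] sum_mono abs_cubic_conv_le[OF assms(1)] w)
  also have "\<dots> = (\<Sum>X\<in>Pow ?V. \<Prod>\<alpha>\<in>?V. ?N (?w X \<alpha>)) - (\<Prod>\<alpha>\<in>?V. ?N (?w ?V \<alpha>))"
    by (simp add: sum_diff1 finite_cube_vertices)
  also have "(\<Prod>\<alpha>\<in>?V. ?N (?w ?V \<alpha>)) = (\<Prod>\<alpha>\<in>?V. ?N (f \<alpha>))" by simp
  also have "(\<Sum>X\<in>Pow ?V. \<Prod>\<alpha>\<in>?V. ?N (?w X \<alpha>)) = (\<Prod>\<alpha>\<in>?V. ?N (f \<alpha>) + ?N (?e \<alpha>))"
    unfolding expand by (simp add: if_distrib[of ?N] cong: if_cong)
  finally show ?thesis .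
qed

text \<open>Continuity of the cubic convolution product from \<open>L\<^sup>q\<close> to the uniform norm. It yields continuity in \<open>x\<close>,
  the reduction to test functions, and continuity in the shift parameter \<open>t\<close>.\<close>

lemma cubic_conv_uniform_limit:
  fixes f :: "(nat \<Rightarrow> real) \<Rightarrow> 'a::euclidean_space \<Rightarrow> real"
  assumes "k \<ge> 1" and f: "\<And>\<alpha>. \<alpha> \<in> cube_vertices k \<Longrightarrow> f \<alpha> \<in> Lq (q_exp k)"
    and g: "\<And>n \<alpha>. \<alpha> \<in> cube_vertices k \<Longrightarrow> g n \<alpha> \<in> Lq (q_exp k)"
    and lim: "\<And>\<alpha>. \<alpha> \<in> cube_vertices k \<Longrightarrow> (\<lambda>n. Lq_norm (q_exp k) (\<lambda>y. g n \<alpha> y - f \<alpha> y)) \<longlonglongrightarrow> 0"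
  shows "uniform_limit UNIV (\<lambda>n. cubic_conv k (g n)) (cubic_conv k f) sequentially"
proof (rule uniform_limitI)
  fix e :: real assume "e > 0"
  let ?V = "cube_vertices k" and ?N = "Lq_norm (q_exp k)"
  let ?R = "\<lambda>n. (\<Prod>\<alpha>\<in>?V. ?N (f \<alpha>) + ?N (\<lambda>y. g n \<alpha> y - f \<alpha> y)) - (\<Prod>\<alpha>\<in>?V. ?N (f \<alpha>))"
  have "?R \<longlonglongrightarrow> (\<Prod>\<alpha>\<in>?V. ?N (f \<alpha>) + 0) - (\<Prod>\<alpha>\<in>?V. ?N (f \<alpha>))"
    by (intro tendsto_diff tendsto_prod tendsto_add tendsto_const lim)
  then have "\<forall>\<^sub>F n in sequentially. ?R n < e" using \<open>e > 0\<close> by (intro order_tendstoD(2)) auto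
  then show "\<forall>\<^sub>F n in sequentially. \<forall>x\<in>UNIV. dist (cubic_conv k (g n) x) (cubic_conv k f x) < e"
  proof eventually_elim
    case (elim n)
    then show ?case
      using cubic_conv_diff_le[where f = f and g = "g n", OF assms(1) f g]
      by (auto simp: dist_real_def intro: le_less_trans)
  qed
qed

section \<open>Density of test functions\<close>

lemma Lq_norm_dominated_convergence:
  fixes u :: "nat \<Rightarrow> 'a::euclidean_space \<Rightarrow> real"
  assumes "q > 0" and w: "w \<in> Lq q"
    and u: "\<And>n. u n \<in> borel_measurable borel" "v \<in> borel_measurable borel"
    and lim: "AE x in lborel. (\<lambda>n. u n x) \<longlonglongrightarrow> v x"
    and bound: "\<And>n x. \<bar>u n x\<bar> \<le> w x"
  shows "(\<lambda>n. Lq_norm q (u n)) \<longlonglongrightarrow> Lq_norm q v"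
proof -
  have "(\<lambda>n. LINT x|lborel. \<bar>u n x\<bar> powr q) \<longlonglongrightarrow> (LINT x|lborel. \<bar>v x\<bar> powr q)"
  proof (rule integral_dominated_convergence)
    show "integrable lborel (\<lambda>x. \<bar>w x\<bar> powr q)" by (rule Lq_integrable[OF w])
    show "AE x in lborel. (\<lambda>n. \<bar>u n x\<bar> powr q) \<longlonglongrightarrow> \<bar>v x\<bar> powr q"
      using lim by eventually_elim (use assms(1) in \<open>auto intro!: tendsto_powr2 tendsto_rabs\<close>)
    have "\<bar>u n x\<bar> \<le> \<bar>w x\<bar>" for n x using bound[of n x] by linarith
    then show "AE x in lborel. norm (\<bar>u n x\<bar> powr q) \<le> \<bar>w x\<bar> powr q" for n
      using assms(1) by (intro AE_I2) (auto intro!: powr_mono2)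
  qed (use u in measurable)
  then show ?thesis
    unfolding Lq_norm_def using assms(1) by (intro tendsto_powr2) auto
qed

lemma Lq_dominated:
  assumes "q > 0" "w \<in> Lq q" "u \<in> borel_measurable borel" "\<And>x. \<bar>u x\<bar> \<le> w x"
  shows "u \<in> Lq q"
proof (rule LqI)
  have "\<bar>u x\<bar> \<le> \<bar>w x\<bar>" for x using assms(4)[of x] by linarith
  then show "integrable lborel (\<lambda>x. \<bar>u x\<bar> powr q)"
    using assms(1,3)
    by (intro Bochner_Integration.integrable_bound[OF Lq_integrable[OF assms(2)]])
      (auto intro!: AE_I2 powr_mono2)
qed fact

lemma Lq_indicator_cball: "(\<lambda>x::'a::euclidean_space. c * indicator (cball 0 r) x) \<in> Lq q"
proof (rule Lq_cmult, rule LqI)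
  have "\<bar>indicator (cball 0 r) x\<bar> powr q = indicator (cball (0::'a) r) x" for x :: 'a
    by (simp add: indicator_def)
  then show "integrable lborel (\<lambda>x::'a. \<bar>indicator (cball 0 r) x\<bar> powr q)"
    using emeasure_lborel_cball_finite[of "0::'a" r] by simp
qed (auto intro!: borel_measurable_indicator)

text \<open>Continuous functions of compact support, the support condition being expressed by a radius.\<close>

definition test_function :: "('a::euclidean_space \<Rightarrow> real) \<Rightarrow> bool" where
  "test_function f \<longleftrightarrow> continuous_on UNIV f \<and> (\<exists>r. \<forall>x. norm x > r \<longrightarrow> f x = 0)"

lemma test_function_bound:
  assumes "test_function f"
  obtains b r where "b \<ge> 0" "\<And>x. \<bar>f x\<bar> \<le> b * indicator (cball 0 r) x"
proof -
  obtain r where r: "\<And>x. norm x > r \<Longrightarrow> f x = 0"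
    using assms unfolding test_function_def by blast
  have "compact (f ` cball 0 r)"
    using assms by (intro compact_continuous_image) (auto simp: test_function_def intro: continuous_on_subset)
  then have "bounded (f ` cball 0 r)" by (rule compact_imp_bounded)
  then obtain b where "\<forall>y\<in>f ` cball 0 r. norm y \<le> b" unfolding bounded_iff ..
  then have b: "\<And>x. norm x \<le> r \<Longrightarrow> \<bar>f x\<bar> \<le> b" by auto
  have "\<bar>f x\<bar> \<le> max 0 b * indicator (cball 0 (max 0 r)) x" for x
    using r[of x] b[of x] by (cases "norm x \<le> r") (auto simp: indicator_def)
  then show thesis using that[of "max 0 b" "max 0 r"] by simp
qed

lemma test_function_continuous: "test_function f \<Longrightarrow> continuous_on UNIV f"
  by (simp add: test_function_def)

lemma test_function_measurable: "test_function f \<Longrightarrow> f \<in> borel_measurable borel"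
  by (intro borel_measurable_continuous_onI test_function_continuous)

lemma test_function_Lq:
  assumes "test_function f" "q > 0"
  shows "f \<in> Lq q"
  using assms test_function_bound[OF assms(1)]
  by (metis Lq_dominated Lq_indicator_cball test_function_measurable)

text \<open>A measurable function is the almost everywhere limit of continuous functions \<open>g n\<close>. Clamping these to \<open>[- r, r]\<close> and
  multiplying by a continuous cutoff makes them test functions with a common bound, so that dominated
  convergence turns the pointwise limit into one in \<open>L\<^sup>q\<close>.\<close>

lemma bounded_support_approx:
  fixes f :: "'a::euclidean_space \<Rightarrow> real"
  assumes "q > 0" and [measurable]: "f \<in> borel_measurable borel" and "r \<ge> 0"
    and bound: "\<And>x. \<bar>f x\<bar> \<le> r * indicator (cball 0 r) x"
  obtains h where "\<And>n. test_function (h n)"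
    "(\<lambda>n. Lq_norm q (\<lambda>x. h n x - f x)) \<longlonglongrightarrow> 0" "(\<lambda>n. Lq_norm q (h n)) \<longlonglongrightarrow> Lq_norm q f"
proof -
  have "f measurable_on UNIV" by (intro lebesgue_measurable_imp_measurable_on measurable_completion) auto
  then obtain N g where N: "negligible N" and g: "\<And>n. continuous_on UNIV (g n)"
    and lim: "\<And>x. x \<notin> N \<Longrightarrow> (\<lambda>n. g n x) \<longlonglongrightarrow> f x"
    unfolding measurable_on_def by auto
  define cut where "cut = (\<lambda>x::'a. max 0 (min 1 (r + 1 - norm x)))"
  define h where "h = (\<lambda>n x. cut x * max (- r) (min r (g n x)))"
  have cut: "0 \<le> cut x" "cut x \<le> 1" "norm x > r + 1 \<Longrightarrow> cut x = 0" "norm x \<le> r \<Longrightarrow> cut x = 1" for x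
    unfolding cut_def by auto
  have h: "test_function (h n)" for n
    unfolding test_function_def
  proof
    show "continuous_on UNIV (h n)" unfolding h_def cut_def by (intro continuous_intros g)
    show "\<exists>R. \<forall>x. norm x > R \<longrightarrow> h n x = 0" by (auto simp: h_def cut(3) intro: exI[of _ "r + 1"])
  qed
  have h_bound: "\<bar>h n x\<bar> \<le> r * indicator (cball 0 (r + 1)) x" for n x
  proof -
    have "\<bar>max (- r) (min r (g n x))\<bar> \<le> r" using assms(3) by auto
    then have "\<bar>h n x\<bar> \<le> 1 * r"
      unfolding h_def abs_mult using cut[of x] by (intro mult_mono) auto
    then show ?thesis using cut(3)[of x] by (cases "x \<in> cball 0 (r + 1)") (auto simp: h_def)
  qed
  have f_bound: "\<bar>f x\<bar> \<le> r * indicator (cball 0 (r + 1)) x" for x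
    using bound[of x] assms(3)
    by (cases "x \<in> cball 0 r"; cases "x \<in> cball 0 (r + 1)") auto
  have h_lim: "(\<lambda>n. h n x) \<longlonglongrightarrow> f x" if "x \<notin> N" for x
  proof -
    have "(\<lambda>n. h n x) \<longlonglongrightarrow> cut x * max (- r) (min r (f x))"
      unfolding h_def by (intro tendsto_intros lim that)
    moreover have "cut x * max (- r) (min r (f x)) = f x"
      using bound[of x] assms(3) cut(4)[of x] by (cases "x \<in> cball 0 r") auto
    ultimately show ?thesis by simp
  qed
  have AE: "AE x in lborel. (\<lambda>n. h n x) \<longlonglongrightarrow> f x"
  proof -
    have "AE x in lebesgue. x \<notin> N" using N by (intro AE_not_in) (simp add: negligible_iff_null_sets)
    then have "AE x in lebesgue. (\<lambda>n. h n x) \<longlonglongrightarrow> f x" by eventually_elim (rule h_lim)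
    then show ?thesis by (simp add: AE_completion_iff)
  qed
  have meas [measurable]: "h n \<in> borel_measurable borel" for n by (rule test_function_measurable[OF h])
  show thesis
  proof
    show "test_function (h n)" for n by (rule h)
    show "(\<lambda>n. Lq_norm q (h n)) \<longlonglongrightarrow> Lq_norm q f"
      by (rule Lq_norm_dominated_convergence[OF assms(1) Lq_indicator_cball _ _ AE h_bound]) measurable
    have "(\<lambda>n. Lq_norm q (\<lambda>x. h n x - f x)) \<longlonglongrightarrow> Lq_norm q (\<lambda>x::'a. 0)"
    proof (rule Lq_norm_dominated_convergence[OF assms(1) Lq_indicator_cball[of "2 * r" "r + 1"]])
      show "AE x in lborel. (\<lambda>n. h n x - f x) \<longlonglongrightarrow> 0"
        using AE by eventually_elim (auto intro: LIM_zero)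
      show "\<bar>h n x - f x\<bar> \<le> 2 * r * indicator (cball 0 (r + 1)) x" for n x
        using h_bound[of n x] f_bound[of x] by (cases "x \<in> cball 0 (r + 1)") auto
    qed measurable
    then show "(\<lambda>n. Lq_norm q (\<lambda>x. h n x - f x)) \<longlonglongrightarrow> 0"
      using assms(1) by (simp add: Lq_norm_def)
  qed
qed

text \<open>A crude substitute for Minkowski's inequality that is good enough for limits.\<close>

lemma Lq_norm_quasi_triangle:
  fixes f g h :: "'a::euclidean_space \<Rightarrow> real"
  assumes "q > 0" "(\<lambda>x. f x - g x) \<in> Lq q" "(\<lambda>x. g x - h x) \<in> Lq q"
  shows "Lq_norm q (\<lambda>x. f x - h x) powr q
    \<le> 2 powr q * (Lq_norm q (\<lambda>x. f x - g x) powr q + Lq_norm q (\<lambda>x. g x - h x) powr q)"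
proof -
  have norm_powr: "Lq_norm q u powr q = (LINT x|lborel. \<bar>u x\<bar> powr q)" for u :: "'a \<Rightarrow> real"
    using assms(1) by (simp add: Lq_norm_def powr_powr)
  note int = Lq_integrable[OF assms(2)] Lq_integrable[OF assms(3)]
  have "(\<lambda>x. h x - g x) \<in> Lq q" using Lq_cmult[OF assms(3), of "-1"] by simp
  from Lq_diff[OF assms(2) this] have fh: "(\<lambda>x. f x - h x) \<in> Lq q" using assms(1) by simp
  have "(LINT x|lborel. \<bar>f x - h x\<bar> powr q)
    \<le> (LINT x|lborel. 2 powr q * (\<bar>f x - g x\<bar> powr q + \<bar>g x - h x\<bar> powr q))"
  proof (intro integral_mono integrable_mult_right Bochner_Integration.integrable_add int Lq_integrable[OF fh])
    fix x
    show "\<bar>f x - h x\<bar> powr q \<le> 2 powr q * (\<bar>f x - g x\<bar> powr q + \<bar>g x - h x\<bar> powr q)"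
      using abs_diff_powr_le[of q "f x - g x" "h x - g x"] assms(1) by (simp add: abs_minus_commute)
  qed
  also have "\<dots> = 2 powr q * ((LINT x|lborel. \<bar>f x - g x\<bar> powr q) + (LINT x|lborel. \<bar>g x - h x\<bar> powr q))"
    using int by simp
  finally show ?thesis unfolding norm_powr .
qed

lemma Lq_norm_tendsto_0_iff:
  assumes "q > 0"
  shows "(\<lambda>n. Lq_norm q (u n)) \<longlonglongrightarrow> 0 \<longleftrightarrow> (\<lambda>n. Lq_norm q (u n) powr q) \<longlonglongrightarrow> 0"
proof
  assume "(\<lambda>n. Lq_norm q (u n)) \<longlonglongrightarrow> 0"
  then have "(\<lambda>n. Lq_norm q (u n) powr q) \<longlonglongrightarrow> 0 powr q"
    using assms by (intro tendsto_powr2) (auto simp: Lq_norm_nonneg)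
  then show "(\<lambda>n. Lq_norm q (u n) powr q) \<longlonglongrightarrow> 0" using assms by simp
next
  assume "(\<lambda>n. Lq_norm q (u n) powr q) \<longlonglongrightarrow> 0"
  then have "(\<lambda>n. (Lq_norm q (u n) powr q) powr (1 / q)) \<longlonglongrightarrow> 0 powr (1 / q)"
    using assms by (intro tendsto_powr2) (auto simp: Lq_norm_nonneg)
  then show "(\<lambda>n. Lq_norm q (u n)) \<longlonglongrightarrow> 0" using assms by (simp add: powr_powr Lq_norm_nonneg)
qed

text \<open>Truncate \<open>f\<close> in size and in space, then approximate the truncations. Convergence of the norms is a separate
  conclusion since the quasi-triangle inequality does not derive it from convergence of the differences.\<close>

lemma test_functions_dense:
  fixes f :: "'a::euclidean_space \<Rightarrow> real"
  assumes "q > 0" and f: "f \<in> Lq q"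
  obtains h where "\<And>n. test_function (h n)"
    "(\<lambda>n. Lq_norm q (\<lambda>x. h n x - f x)) \<longlonglongrightarrow> 0" "(\<lambda>n. Lq_norm q (h n)) \<longlonglongrightarrow> Lq_norm q f"
proof -
  have [measurable]: "f \<in> borel_measurable borel" using f by measurable
  define t where "t = (\<lambda>(n::nat) x. if \<bar>f x\<bar> \<le> real n \<and> norm x \<le> real n then f x else 0)"
  have t_meas [measurable]: "t n \<in> borel_measurable borel" for n unfolding t_def by measurable
  have abs_f: "(\<lambda>x. \<bar>f x\<bar>) \<in> Lq q" using f by (intro LqI) (auto dest: Lq_integrable)
  have t_Lq: "t n \<in> Lq q" for n by (rule Lq_dominated[OF assms(1) abs_f]) (auto simp: t_def)
  have t_lim: "(\<lambda>n. t n x) \<longlonglongrightarrow> f x" for x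
  proof (rule tendsto_eventually)
    show "\<forall>\<^sub>F n in sequentially. t n x = f x"
      using eventually_ge_at_top[of "nat \<lceil>max \<bar>f x\<bar> (norm x)\<rceil>"]
    proof eventually_elim
      case (elim n)
      then have "max \<bar>f x\<bar> (norm x) \<le> real n" by linarith
      then show ?case by (simp add: t_def)
    qed
  qed
  have t_norm: "(\<lambda>n. Lq_norm q (t n)) \<longlonglongrightarrow> Lq_norm q f"
    by (rule Lq_norm_dominated_convergence[OF assms(1) abs_f _ _ AE_I2[OF t_lim]])
      (auto simp: t_def)
  have "(\<lambda>n. Lq_norm q (\<lambda>x. t n x - f x)) \<longlonglongrightarrow> Lq_norm q (\<lambda>x::'a. 0)"
    by (rule Lq_norm_dominated_convergence[OF assms(1) abs_f _ _ AE_I2[OF LIM_zero[OF t_lim]]])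
      (auto simp: t_def)
  then have t_diff: "(\<lambda>n. Lq_norm q (\<lambda>x. t n x - f x) powr q) \<longlonglongrightarrow> 0"
    using assms(1) by (subst Lq_norm_tendsto_0_iff[symmetric]) (auto simp: Lq_norm_def)
  have "\<exists>h. test_function h \<and> Lq_norm q (\<lambda>x. h x - t n x) powr q < 1 / real (Suc n)
      \<and> \<bar>Lq_norm q h - Lq_norm q (t n)\<bar> < 1 / real (Suc n)" for n
  proof -
    have "\<bar>t n x\<bar> \<le> real n * indicator (cball 0 (real n)) x" for x
      by (auto simp: t_def indicator_def)
    then obtain h where h: "\<And>m. test_function (h m)"
      "(\<lambda>m. Lq_norm q (\<lambda>x. h m x - t n x)) \<longlonglongrightarrow> 0" "(\<lambda>m. Lq_norm q (h m)) \<longlonglongrightarrow> Lq_norm q (t n)"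
      using bounded_support_approx[OF assms(1) t_meas, of "real n" n] by auto
    have "\<forall>\<^sub>F m in sequentially. Lq_norm q (\<lambda>x. h m x - t n x) powr q < 1 / real (Suc n)"
      using h(2) assms(1) by (intro order_tendstoD(2)[where y = 0]) (auto simp: Lq_norm_tendsto_0_iff)
    moreover have "\<forall>\<^sub>F m in sequentially. \<bar>Lq_norm q (h m) - Lq_norm q (t n)\<bar> < 1 / real (Suc n)"
      using tendstoD[OF h(3), of "1 / real (Suc n)"] by (simp add: dist_real_def)
    ultimately have "\<forall>\<^sub>F m in sequentially. Lq_norm q (\<lambda>x. h m x - t n x) powr q < 1 / real (Suc n)
        \<and> \<bar>Lq_norm q (h m) - Lq_norm q (t n)\<bar> < 1 / real (Suc n)" by eventually_elim simp
    from eventually_happens[OF this] show ?thesis using h(1) by auto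
  qed
  then have "\<exists>h. \<forall>n. test_function (h n) \<and> Lq_norm q (\<lambda>x. h n x - t n x) powr q < 1 / real (Suc n)
      \<and> \<bar>Lq_norm q (h n) - Lq_norm q (t n)\<bar> < 1 / real (Suc n)" by (intro choice allI)
  then obtain h where h: "\<And>n. test_function (h n)"
    "\<And>n. Lq_norm q (\<lambda>x. h n x - t n x) powr q < 1 / real (Suc n)"
    "\<And>n. \<bar>Lq_norm q (h n) - Lq_norm q (t n)\<bar> < 1 / real (Suc n)" by blast
  show thesis
  proof
    show "test_function (h n)" for n by fact
    have lim0: "(\<lambda>n. 1 / real (Suc n)) \<longlonglongrightarrow> 0" by (rule LIMSEQ_Suc[OF lim_1_over_n])
    have "(\<lambda>n. Lq_norm q (h n) - Lq_norm q (t n)) \<longlonglongrightarrow> 0"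
    proof (rule Lim_null_comparison[OF always_eventually[OF allI] lim0])
      show "norm (Lq_norm q (h n) - Lq_norm q (t n)) \<le> 1 / real (Suc n)" for n
        unfolding real_norm_def by (rule less_imp_le[OF h(3)])
    qed
    from tendsto_add[OF this t_norm] show "(\<lambda>n. Lq_norm q (h n)) \<longlonglongrightarrow> Lq_norm q f" by simp
    have "(\<lambda>n. Lq_norm q (\<lambda>x. h n x - f x) powr q) \<longlonglongrightarrow> 0"
    proof (rule Lim_null_comparison)
      have "Lq_norm q (\<lambda>x. h n x - f x) powr q
        \<le> 2 powr q * (1 / real (Suc n) + Lq_norm q (\<lambda>x. t n x - f x) powr q)" for n
      proof -
        have "Lq_norm q (\<lambda>x. h n x - f x) powr q
          \<le> 2 powr q * (Lq_norm q (\<lambda>x. h n x - t n x) powr q + Lq_norm q (\<lambda>x. t n x - f x) powr q)"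
          using assms(1) by (intro Lq_norm_quasi_triangle Lq_diff t_Lq f test_function_Lq h) auto
        also have "\<dots> \<le> 2 powr q * (1 / real (Suc n) + Lq_norm q (\<lambda>x. t n x - f x) powr q)"
          using h(2)[of n] by (intro mult_left_mono add_right_mono) auto
        finally show ?thesis .
      qed
      then show "\<forall>\<^sub>F n in sequentially. norm (Lq_norm q (\<lambda>x. h n x - f x) powr q)
        \<le> 2 powr q * (1 / real (Suc n) + Lq_norm q (\<lambda>x. t n x - f x) powr q)" by simp
      show "(\<lambda>n. 2 powr q * (1 / real (Suc n) + Lq_norm q (\<lambda>x. t n x - f x) powr q)) \<longlonglongrightarrow> 0"
        using tendsto_mult_left[OF tendsto_add[OF lim0 t_diff], of "2 powr q"] by simp
    qed
    then show "(\<lambda>n. Lq_norm q (\<lambda>x. h n x - f x)) \<longlonglongrightarrow> 0"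
      using assms(1) by (simp add: Lq_norm_tendsto_0_iff)
  qed
qed

lemma Lq_norm_translation_tendsto:
  fixes f :: "'a::euclidean_space \<Rightarrow> real"
  assumes "test_function f" "q > 0" "z \<longlonglongrightarrow> 0"
  shows "(\<lambda>n. Lq_norm q (\<lambda>y. f (y + z n) - f y)) \<longlonglongrightarrow> 0"
proof -
  obtain b r where b: "b \<ge> 0" "\<And>x. \<bar>f x\<bar> \<le> b * indicator (cball 0 r) x"
    using test_function_bound[OF assms(1)] by metis
  obtain s where s: "\<And>n. norm (z n) \<le> s"
    using convergent_imp_Bseq[OF convergentI[OF assms(3)]] by (auto simp: Bseq_def)
  have [measurable]: "f \<in> borel_measurable borel" by (rule test_function_measurable[OF assms(1)])
  have "(\<lambda>n. Lq_norm q (\<lambda>y. f (y + z n) - f y)) \<longlonglongrightarrow> Lq_norm q (\<lambda>y::'a. 0)"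
  proof (rule Lq_norm_dominated_convergence[OF assms(2) Lq_indicator_cball[of "2 * b" "r + s"]])
    have "(\<lambda>n. f (x + z n) - f x) \<longlonglongrightarrow> f (x + 0) - f x" for x
      by (intro tendsto_diff tendsto_const continuous_on_tendsto_compose[OF
            test_function_continuous[OF assms(1)]] tendsto_add assms(3)) auto
    then show "AE x in lborel. (\<lambda>n. f (x + z n) - f x) \<longlonglongrightarrow> 0" by simp
    fix n x
    have "norm x \<le> r + s" if "norm (x + z n) \<le> r \<or> norm x \<le> r"
      using that s[of n] norm_triangle_ineq4[of "x + z n" "z n"] norm_ge_zero[of "z n"]
      by (auto simp del: norm_ge_zero)
    then show "\<bar>f (x + z n) - f x\<bar> \<le> 2 * b * indicator (cball 0 (r + s)) x"
      using b(2)[of "x + z n"] b(2)[of x] b(1)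
      by (cases "norm (x + z n) \<le> r"; cases "norm x \<le> r"; cases "norm x \<le> r + s") simp_all
  qed measurable
  then show ?thesis using assms(2) by (simp add: Lq_norm_def)
qed

text \<open>Moving the point \<open>x\<close> amounts to translating all the functions, and translation is continuous in \<open>L\<^sup>q\<close>.\<close>

lemma continuous_cubic_conv:
  fixes f :: "(nat \<Rightarrow> real) \<Rightarrow> 'a::euclidean_space \<Rightarrow> real"
  assumes "k \<ge> 1" and f: "\<And>\<alpha>. \<alpha> \<in> cube_vertices k \<Longrightarrow> test_function (f \<alpha>)"
  shows "continuous_on UNIV (cubic_conv k f)"
  unfolding continuous_on_sequentially
proof (intro allI ballI impI)
  fix u and x :: 'a assume "(\<forall>n. u n \<in> UNIV) \<and> u \<longlonglongrightarrow> x"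
  then have "(\<lambda>n. u n - x) \<longlonglongrightarrow> 0" by (simp add: LIM_zero)
  have q: "q_exp k > 0" using q_exp_ge_1[OF assms(1)] by simp
  have "test_function (\<lambda>y. f \<alpha> (y + z))" if "\<alpha> \<in> cube_vertices k" for \<alpha> z
  proof -
    note f\<alpha> = f[OF that]
    obtain r where r: "\<And>x. norm x > r \<Longrightarrow> f \<alpha> x = 0" using f\<alpha> by (auto simp: test_function_def)
    have "norm (y + z) > r" if "norm y > r + norm z" for y
      using that norm_triangle_ineq4[of "y + z" z] by simp
    then have "\<forall>y. norm y > r + norm z \<longrightarrow> f \<alpha> (y + z) = 0" using r by blast
    moreover have "continuous_on UNIV (\<lambda>y. f \<alpha> (y + z))"
      by (intro continuous_on_compose2[OF test_function_continuous[OF f\<alpha>]] continuous_intros) auto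
    ultimately show ?thesis unfolding test_function_def by blast
  qed
  then have "uniform_limit UNIV (\<lambda>n. cubic_conv k (\<lambda>\<alpha> y. f \<alpha> (y + (u n - x)))) (cubic_conv k f) sequentially"
    using f q by (intro cubic_conv_uniform_limit[OF assms(1)] Lq_norm_translation_tendsto
      test_function_Lq \<open>(\<lambda>n. u n - x) \<longlonglongrightarrow> 0\<close>) auto
  then have "(\<lambda>n. cubic_conv k (\<lambda>\<alpha> y. f \<alpha> (y + (u n - x))) x) \<longlonglongrightarrow> cubic_conv k f x"
    by (rule tendsto_uniform_limitI) simp
  moreover have "cubic_conv k (\<lambda>\<alpha> y. f \<alpha> (y + (u n - x))) x = cubic_conv k f (u n)" for n
    unfolding cubic_conv_def by (simp add: algebra_simps)
  ultimately show "((cubic_conv k f) \<circ> u) \<longlonglongrightarrow> cubic_conv k f x" by (simp add: comp_def)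
qed

lemma cubic_conv_bcontfun:
  fixes f :: "(nat \<Rightarrow> real) \<Rightarrow> 'a::euclidean_space \<Rightarrow> real"
  assumes "k \<ge> 1" and f: "\<And>\<alpha>. \<alpha> \<in> cube_vertices k \<Longrightarrow> test_function (f \<alpha>)"
  shows "apply_bcontfun (Bcontfun (cubic_conv k f)) = cubic_conv k f"
proof (rule Bcontfun_inverse, rule bcontfun_normI)
  have q: "q_exp k > 0" using q_exp_ge_1[OF assms(1)] by simp
  show "continuous_on UNIV (cubic_conv k f)" by (rule continuous_cubic_conv[OF assms])
  show "norm (cubic_conv k f x) \<le> (\<Prod>\<alpha>\<in>cube_vertices k. Lq_norm (q_exp k) (f \<alpha>))" for x
    using abs_cubic_conv_le[OF assms(1) test_function_Lq[OF f q]] by simp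
qed

section \<open>The Banach algebra generated by a closed convex set\<close>

text \<open>The Minkowski functional of \<open>K\<close>.\<close>

definition gauge_of :: "'v::real_vector set \<Rightarrow> 'v \<Rightarrow> real" where
  "gauge_of K x = Inf {t. t > 0 \<and> x \<in> (\<lambda>u. t *\<^sub>R u) ` K}"

text \<open>The unit balls of complete norms that dominate the ambient norm. Closedness makes limits of elements of a multiple of
  \<open>K\<close> stay there; boundedness makes the gauge definite.\<close>

locale banach_disc =
  fixes K :: "'v::{real_normed_vector, complete_space} set"
  assumes closed: "closed K" and convex: "convex K" and zero: "0 \<in> K"
    and symmetric: "x \<in> K \<Longrightarrow> - x \<in> K" and norm_le_1: "x \<in> K \<Longrightarrow> norm x \<le> 1"
begin

lemma scale_mem:
  assumes "x \<in> K" "\<bar>c\<bar> \<le> 1"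
  shows "c *\<^sub>R x \<in> K"
proof -
  have pos: "c *\<^sub>R x \<in> K" if "x \<in> K" "0 \<le> c" "c \<le> 1" for c x
    using convexD[OF convex zero that(1), of "1 - c" c] that by simp
  show ?thesis
  proof (cases "c \<ge> 0")
    case False
    then have "(- c) *\<^sub>R (- x) \<in> K" using assms by (intro pos symmetric) auto
    then show ?thesis by simp
  qed (use assms pos in auto)
qed

lemma scale_mono:
  assumes "x \<in> (\<lambda>u. s *\<^sub>R u) ` K" "0 < s" "s \<le> t"
  shows "x \<in> (\<lambda>u. t *\<^sub>R u) ` K"
proof -
  obtain u where u: "u \<in> K" "x = s *\<^sub>R u" using assms(1) by auto
  have "x = t *\<^sub>R ((s / t) *\<^sub>R u)" using assms u by simp
  moreover have "(s / t) *\<^sub>R u \<in> K" using assms u by (intro scale_mem) auto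
  ultimately show ?thesis by blast
qed

lemma scale_add:
  assumes "x \<in> (\<lambda>u. s *\<^sub>R u) ` K" "y \<in> (\<lambda>u. t *\<^sub>R u) ` K" "s > 0" "t > 0"
  shows "x + y \<in> (\<lambda>u. (s + t) *\<^sub>R u) ` K"
proof -
  obtain u v where uv: "u \<in> K" "x = s *\<^sub>R u" "v \<in> K" "y = t *\<^sub>R v" using assms(1,2) by auto
  have "x + y = (s + t) *\<^sub>R ((s / (s + t)) *\<^sub>R u + (t / (s + t)) *\<^sub>R v)"
    using assms(3,4) uv by (simp add: scaleR_add_right)
  moreover have "(s / (s + t)) *\<^sub>R u + (t / (s + t)) *\<^sub>R v \<in> K"
    using assms(3,4) uv by (intro convexD[OF convex]) (auto simp flip: add_divide_distrib)
  ultimately show ?thesis by blast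
qed

lemma scale_scale:
  assumes "x \<in> (\<lambda>u. s *\<^sub>R u) ` K" "c \<noteq> 0"
  shows "c *\<^sub>R x \<in> (\<lambda>u. (\<bar>c\<bar> * s) *\<^sub>R u) ` K"
proof -
  obtain u where u: "u \<in> K" "x = s *\<^sub>R u" using assms(1) by auto
  have "c *\<^sub>R x = (\<bar>c\<bar> * s) *\<^sub>R (sgn c *\<^sub>R u)"
    using u by (simp add: mult.assoc[symmetric] mult.commute[of s] abs_mult_sgn mult.left_commute)
  moreover have "sgn c *\<^sub>R u \<in> K" using u by (intro scale_mem) (auto simp: sgn_if)
  ultimately show ?thesis by blast
qed

lemma span_eq: "span K = {x. \<exists>t>0. x \<in> (\<lambda>u. t *\<^sub>R u) ` K}" (is "_ = ?S")
proof
  have "subspace ?S"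
  proof (rule subspaceI)
    show "0 \<in> ?S" using zero by (auto intro!: exI[of _ 1])
    show "x + y \<in> ?S" if "x \<in> ?S" "y \<in> ?S" for x y
      using that scale_add[of x _ y] by (blast intro: add_pos_pos)
    show "c *\<^sub>R x \<in> ?S" if "x \<in> ?S" for c x
    proof (cases "c = 0")
      case True
      then show ?thesis using \<open>0 \<in> ?S\<close> by simp
    next
      case False
      from that obtain t where "t > 0" "x \<in> (\<lambda>u. t *\<^sub>R u) ` K" by blast
      with scale_scale[OF this(2) False] False show ?thesis
        by (intro CollectI exI[of _ "\<bar>c\<bar> * t"]) simp
    qed
  qed
  moreover have "K \<subseteq> ?S" by (auto intro!: exI[of _ 1])
  ultimately show "span K \<subseteq> ?S" using span_minimal by blast
qed (auto intro: span_scale span_base)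

lemma gauge_le: "x \<in> (\<lambda>u. t *\<^sub>R u) ` K \<Longrightarrow> t > 0 \<Longrightarrow> gauge_of K x \<le> t"
  unfolding gauge_of_def by (rule cInf_lower) (auto intro!: bdd_belowI[of _ 0])

lemma gauge_nonneg:
  assumes "x \<in> span K"
  shows "0 \<le> gauge_of K x"
  unfolding gauge_of_def using assms unfolding span_eq by (intro cInf_greatest) auto

lemma mem_scale_if_gauge_less:
  assumes "x \<in> span K" "gauge_of K x < t"
  shows "x \<in> (\<lambda>u. t *\<^sub>R u) ` K"
proof -
  have "\<exists>s\<in>{t. t > 0 \<and> x \<in> (\<lambda>u. t *\<^sub>R u) ` K}. s < t"
    using assms unfolding gauge_of_def span_eq by (intro cInf_lessD) auto
  then show ?thesis using scale_mono by fastforce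
qed

lemma norm_le_gauge:
  assumes "x \<in> span K"
  shows "norm x \<le> gauge_of K x"
proof (rule dense_ge)
  fix t assume t: "gauge_of K x < t"
  then obtain u where "u \<in> K" "x = t *\<^sub>R u" using mem_scale_if_gauge_less[OF assms] by auto
  then show "norm x \<le> t"
    using t gauge_nonneg[OF assms] norm_le_1[of u] by (simp add: mult_left_le)
qed

lemma gauge_zero: "gauge_of K 0 = 0"
proof (rule antisym)
  show "gauge_of K 0 \<le> 0"
  proof (rule dense_ge)
    fix t :: real assume "0 < t"
    then show "gauge_of K 0 \<le> t" using zero by (intro gauge_le) force+
  qed
qed (simp add: gauge_nonneg span_zero)

lemma gauge_scaleR_le:
  assumes "x \<in> span K"
  shows "gauge_of K (c *\<^sub>R x) \<le> \<bar>c\<bar> * gauge_of K x"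
proof (cases "c = 0")
  case False
  have "gauge_of K (c *\<^sub>R x) / \<bar>c\<bar> \<le> gauge_of K x"
  proof (rule dense_ge)
    fix t assume t: "gauge_of K x < t"
    then have "t > 0" using gauge_nonneg[OF assms] by simp
    then have "gauge_of K (c *\<^sub>R x) \<le> \<bar>c\<bar> * t"
      using False by (intro gauge_le scale_scale mem_scale_if_gauge_less assms t) auto
    then show "gauge_of K (c *\<^sub>R x) / \<bar>c\<bar> \<le> t" using False by (simp add: field_simps)
  qed
  then show ?thesis using False by (simp add: field_simps)
qed (simp add: gauge_zero)

lemma gauge_scaleR:
  assumes "x \<in> span K"
  shows "gauge_of K (c *\<^sub>R x) = \<bar>c\<bar> * gauge_of K x"
proof (cases "c = 0")
  case False
  have "gauge_of K ((1 / c) *\<^sub>R (c *\<^sub>R x)) \<le> \<bar>1 / c\<bar> * gauge_of K (c *\<^sub>R x)"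
    by (intro gauge_scaleR_le span_scale assms)
  then have "\<bar>c\<bar> * gauge_of K x \<le> gauge_of K (c *\<^sub>R x)" using False by (simp add: field_simps)
  then show ?thesis using gauge_scaleR_le[OF assms, of c] by simp
qed (simp add: gauge_zero)

lemma gauge_triangle:
  assumes "x \<in> span K" "y \<in> span K"
  shows "gauge_of K (x + y) \<le> gauge_of K x + gauge_of K y"
proof (rule field_le_epsilon)
  fix e :: real assume "e > 0"
  then have "gauge_of K (x + y) \<le> (gauge_of K x + e / 2) + (gauge_of K y + e / 2)"
    using gauge_nonneg assms
    by (intro gauge_le scale_add mem_scale_if_gauge_less add_nonneg_pos add_pos_pos) auto
  then show "gauge_of K (x + y) \<le> gauge_of K x + gauge_of K y + e" by simp
qed

text \<open>A Cauchy sequence for the gauge is Cauchy for the smaller ambient norm and so has a limit \<open>L\<close> there. Since \<open>e\<close>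
  times \<open>K\<close> is closed, letting \<open>n\<close> tend to infinity in \<open>X m - X n \<in> e K\<close> shows convergence to \<open>L\<close> for the gauge.\<close>

lemma gauge_complete:
  assumes X: "\<And>n. X n \<in> span K"
    and small: "\<And>e. e > 0 \<Longrightarrow> \<exists>M. \<forall>m\<ge>M. \<forall>n\<ge>M. gauge_of K (X m - X n) < e"
  shows "\<exists>L\<in>span K. (\<lambda>n. gauge_of K (X n - L)) \<longlonglongrightarrow> 0"
proof -
  have "Cauchy X"
  proof (rule metric_CauchyI)
    fix e :: real assume "e > 0"
    then obtain M where "\<forall>m\<ge>M. \<forall>n\<ge>M. gauge_of K (X m - X n) < e" using small by blast
    then show "\<exists>M. \<forall>m\<ge>M. \<forall>n\<ge>M. dist (X m) (X n) < e"
      unfolding dist_norm using norm_le_gauge[OF span_diff[OF X X]] by (meson order_le_less_trans)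
  qed
  then obtain L where L: "X \<longlonglongrightarrow> L" using Cauchy_convergent convergent_def by blast
  have close: "\<exists>M. \<forall>m\<ge>M. X m - L \<in> (\<lambda>u. e *\<^sub>R u) ` K" if e: "e > 0" for e
  proof -
    obtain M where M: "\<forall>m\<ge>M. \<forall>n\<ge>M. gauge_of K (X m - X n) < e" using small[OF e] by blast
    have "X m - L \<in> (\<lambda>u. e *\<^sub>R u) ` K" if "m \<ge> M" for m
    proof -
      have "(1 / e) *\<^sub>R (X m - X n) \<in> K" if "n \<ge> M" for n
      proof -
        have "X m - X n \<in> (\<lambda>u. e *\<^sub>R u) ` K"
          using M \<open>m \<ge> M\<close> \<open>n \<ge> M\<close> by (intro mem_scale_if_gauge_less span_diff X) auto
        then show ?thesis using \<open>e > 0\<close> by auto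
      qed
      then have "\<forall>\<^sub>F n in sequentially. (1 / e) *\<^sub>R (X m - X n) \<in> K"
        unfolding eventually_sequentially by blast
      moreover have "(\<lambda>n. (1 / e) *\<^sub>R (X m - X n)) \<longlonglongrightarrow> (1 / e) *\<^sub>R (X m - L)"
        by (intro tendsto_intros L)
      ultimately have "(1 / e) *\<^sub>R (X m - L) \<in> K"
        by (rule Lim_in_closed_set[OF closed _ sequentially_bot])
      moreover have "X m - L = e *\<^sub>R ((1 / e) *\<^sub>R (X m - L))" using \<open>e > 0\<close> by simp
      ultimately show ?thesis by blast
    qed
    then show ?thesis by blast
  qed
  obtain M where "X M - L \<in> (\<lambda>u. 1 *\<^sub>R u) ` K" using close[of 1] by auto
  then have "X M - L \<in> span K" by (auto intro: span_base)
  from span_diff[OF X[of M] this] have LK: "L \<in> span K" by simp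
  have "(\<lambda>n. gauge_of K (X n - L)) \<longlonglongrightarrow> 0"
  proof (rule LIMSEQ_I)
    fix e :: real assume "e > 0"
    then obtain M where M: "\<forall>m\<ge>M. X m - L \<in> (\<lambda>u. (e / 2) *\<^sub>R u) ` K" using close[of "e / 2"] by auto
    have "norm (gauge_of K (X m - L) - 0) < e" if "m \<ge> M" for m
    proof -
      have "gauge_of K (X m - L) \<le> e / 2" using M that \<open>e > 0\<close> by (intro gauge_le) auto
      then show ?thesis using \<open>e > 0\<close> gauge_nonneg[OF span_diff[OF X LK], of m] by simp
    qed
    then show "\<exists>M. \<forall>m\<ge>M. norm (gauge_of K (X m - L) - 0) < e" by blast
  qed
  with LK show ?thesis by blast
qed

lemma scale_mult:
  fixes mult :: "'v \<Rightarrow> 'v \<Rightarrow> 'v"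
  assumes "bounded_bilinear mult" "\<And>x y. x \<in> K \<Longrightarrow> y \<in> K \<Longrightarrow> mult x y \<in> K"
    and "x \<in> (\<lambda>u. s *\<^sub>R u) ` K" "y \<in> (\<lambda>u. t *\<^sub>R u) ` K"
  shows "mult x y \<in> (\<lambda>u. (s * t) *\<^sub>R u) ` K"
proof -
  interpret bounded_bilinear mult by fact
  obtain u v where uv: "u \<in> K" "x = s *\<^sub>R u" "v \<in> K" "y = t *\<^sub>R v" using assms(3,4) by auto
  then have "mult x y = (s * t) *\<^sub>R mult u v" by (simp add: scaleR_left scaleR_right)
  with assms(2)[OF uv(1,3)] show ?thesis by blast
qed

theorem banach_algebra_gauge:
  fixes mult :: "'v \<Rightarrow> 'v \<Rightarrow> 'v"
  assumes mult: "bounded_bilinear mult" and closed_mult: "\<And>x y. x \<in> K \<Longrightarrow> y \<in> K \<Longrightarrow> mult x y \<in> K"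
    and assoc: "\<And>x y z. mult (mult x y) z = mult x (mult y z)"
  shows "banach_algebra_on (span K) (gauge_of K) mult"
proof -
  interpret mult: bounded_bilinear mult by fact
  have span_mult: "mult x y \<in> span K" if "x \<in> span K" "y \<in> span K" for x y
    using that scale_mult[OF mult closed_mult, of x _ y] unfolding span_eq
    by (blast intro: mult_pos_pos)
  have gauge_mult: "gauge_of K (mult x y) \<le> gauge_of K x * gauge_of K y"
    if "x \<in> span K" "y \<in> span K" for x y
  proof -
    have "(\<lambda>n. (gauge_of K x + 1 / real (Suc n)) * (gauge_of K y + 1 / real (Suc n)))
      \<longlonglongrightarrow> (gauge_of K x + 0) * (gauge_of K y + 0)"
      by (intro tendsto_intros LIMSEQ_Suc[OF lim_1_over_n])
    moreover have "gauge_of K (mult x y)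
      \<le> (gauge_of K x + 1 / real (Suc n)) * (gauge_of K y + 1 / real (Suc n))" for n
      using gauge_nonneg that
      by (intro gauge_le scale_mult[OF mult closed_mult] mem_scale_if_gauge_less that
          mult_pos_pos add_nonneg_pos) auto
    ultimately show ?thesis by (intro LIMSEQ_le_const) auto
  qed
  show ?thesis
  proof
    show "gauge_of K x = 0 \<longleftrightarrow> x = 0" if "x \<in> span K" for x
      using norm_le_gauge[OF that] gauge_zero by auto
  qed (simp_all add: gauge_nonneg gauge_scaleR gauge_triangle gauge_complete span_mult assoc
      mult.add_left mult.add_right mult.scaleR_left mult.scaleR_right gauge_mult)
qed

end

section \<open>Closed convex hulls and barycentres\<close>

lemma linear_closure_convex_hull:
  assumes "bounded_linear l" "closed C" "convex C" "\<And>x. x \<in> G \<Longrightarrow> l x \<in> C"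
    and "x \<in> closure (convex hull G)"
  shows "l x \<in> C"
proof -
  have "closure (convex hull G) \<subseteq> l -` C"
  proof (intro closure_minimal hull_minimal)
    show "closed (l -` C)"
      by (intro continuous_closed_vimage assms(2) allI linear_continuous_at assms(1))
    show "convex (l -` C)"
      by (rule convex_linear_vimage[OF bounded_linear.linear[OF assms(1)] assms(3)])
  qed (use assms(4) in auto)
  then show ?thesis using assms(5) by auto
qed

lemma bilinear_closure_convex_hull:
  fixes mult :: "'v::real_normed_vector \<Rightarrow> 'v \<Rightarrow> 'w::real_normed_vector"
  assumes "bounded_bilinear mult" "closed C" "convex C"
    and G: "\<And>x y. x \<in> G \<Longrightarrow> y \<in> G \<Longrightarrow> mult x y \<in> C"
    and xy: "x \<in> closure (convex hull G)" "y \<in> closure (convex hull G)"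
  shows "mult x y \<in> C"
proof (rule linear_closure_convex_hull[OF _ assms(2,3) _ xy(2)])
  show "bounded_linear (mult x)" by (rule bounded_bilinear.bounded_linear_right[OF assms(1)])
  fix y' assume y': "y' \<in> G"
  show "mult x y' \<in> C"
  proof (rule linear_closure_convex_hull[OF _ assms(2,3) _ xy(1), of "\<lambda>x. mult x y'"])
    show "bounded_linear (\<lambda>x. mult x y')"
      by (rule bounded_bilinear.bounded_linear_left[OF assms(1)])
  qed (use G y' in auto)
qed

lemma apply_bcontfun_sum:
  fixes f :: "'i \<Rightarrow> 'a::topological_space \<Rightarrow>\<^sub>C 'b::real_normed_vector"
  shows "apply_bcontfun (\<Sum>i\<in>I. f i) x = (\<Sum>i\<in>I. apply_bcontfun (f i) x)"
  by (induction I rule: infinite_finite_induct) auto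

lemma convex_sum_le_1:
  assumes "convex C" "0 \<in> C" "finite I" "\<And>i. i \<in> I \<Longrightarrow> a i \<ge> 0" "sum a I \<le> 1"
    "\<And>i. i \<in> I \<Longrightarrow> y i \<in> C"
  shows "(\<Sum>i\<in>I. a i *\<^sub>R y i) \<in> C"
proof (cases "sum a I = 0")
  case True
  then have "\<forall>i\<in>I. a i = 0" using assms by (simp add: sum_nonneg_eq_0_iff)
  then show ?thesis using assms(2) by simp
next
  case False
  then have pos: "sum a I > 0" using assms(4) by (simp add: order_less_le sum_nonneg)
  have "(\<Sum>i\<in>I. (a i / sum a I) *\<^sub>R y i) \<in> C"
    using assms pos by (intro convex_sum) (auto simp flip: sum_divide_distrib)
  from convexD[OF assms(1) this assms(2), of "sum a I" "1 - sum a I"]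
  show ?thesis using pos assms(5) by (simp add: scaleR_sum_right)
qed

text \<open>Cover the values of \<open>\<Phi>\<close> by countably many balls of radius \<open>e\<close> with centres \<open>c i\<close> in \<open>K\<close> and make the corresponding
  sets of parameters disjoint. Up to a set \<open>R\<close> of measure less than \<open>e\<close>, finitely many of them, \<open>F i\<close> with \<open>i < n\<close>, exhaust the
  space. The combination of the centres with weights \<open>measure M (F i)\<close> lies in \<open>K\<close>, as \<open>K\<close> contains \<open>0\<close> and the
  weights sum to at most one, and it differs from \<open>g\<close> uniformly by at most \<open>e\<close> from the covered part and \<open>e\<close> from \<open>R\<close>.
  Integrating pointwise in \<open>x\<close> sidesteps vector-valued integration in a space that need not be separable.\<close>

lemma barycentre_mem_closed_convex:
  fixes K :: "('a::topological_space \<Rightarrow>\<^sub>C real) set" and \<Phi> :: "'t \<Rightarrow> 'a \<Rightarrow>\<^sub>C real"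
  assumes K: "closed K" "convex K" "0 \<in> K" "\<And>u. u \<in> K \<Longrightarrow> norm u \<le> 1"
    and mass: "emeasure M (space M) \<le> 1"
    and \<Phi>: "\<And>t. t \<in> space M \<Longrightarrow> \<Phi> t \<in> K"
    and meas: "\<And>x. (\<lambda>t. apply_bcontfun (\<Phi> t) x) \<in> borel_measurable M"
    and cover: "\<And>e. e > 0 \<Longrightarrow> \<exists>c :: nat \<Rightarrow> 'a \<Rightarrow>\<^sub>C real. range c \<subseteq> K \<and>
      (\<forall>i. {t \<in> space M. dist (\<Phi> t) (c i) < e} \<in> sets M) \<and>
      (\<forall>t\<in>space M. \<exists>i. dist (\<Phi> t) (c i) < e)"
    and g: "\<And>x. apply_bcontfun g x = (LINT t|M. apply_bcontfun (\<Phi> t) x)"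
  shows "g \<in> K"
proof -
  interpret finite_measure M
    by (rule finite_measureI) (use mass in \<open>auto simp: top_unique\<close>)
  have mass': "measure M (space M) \<le> 1"
    using mass by (simp add: emeasure_eq_measure)
  have approx: "\<exists>S\<in>K. dist S g \<le> 2 * e" if "e > 0" for e
  proof -
    obtain c :: "nat \<Rightarrow> 'a \<Rightarrow>\<^sub>C real" where cK: "range c \<subseteq> K"
      and cm: "\<And>i. {t \<in> space M. dist (\<Phi> t) (c i) < e} \<in> sets M"
      and cc: "\<And>t. t \<in> space M \<Longrightarrow> \<exists>i. dist (\<Phi> t) (c i) < e"
      using cover[OF \<open>e > 0\<close>] by blast
    define E where "E = (\<lambda>i. {t \<in> space M. dist (\<Phi> t) (c i) < e})"
    define F where "F = disjointed E"
    have FE: "F i \<subseteq> E i" for i unfolding F_def by (rule disjointed_subset)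
    have E_sets: "range E \<subseteq> sets M" using cm by (auto simp: E_def)
    have F_sets [measurable]: "F i \<in> sets M" for i
      using sets.range_disjointed_sets[OF E_sets] by (auto simp: F_def)
    have disj: "disjoint_family F" unfolding F_def by (rule disjoint_family_disjointed)
    have UN: "(\<Union>i. F i) = space M"
      unfolding F_def UN_disjointed_eq using cc by (auto simp: E_def)
    have "(\<lambda>i. measure M (F i)) sums measure M (\<Union>i. F i)"
      by (rule finite_measure_UNION) (use F_sets disj in auto)
    then have "(\<lambda>n. \<Sum>i<n. measure M (F i)) \<longlonglongrightarrow> measure M (space M)" by (simp add: sums_def UN)
    from order_tendstoD(1)[OF this, of "measure M (space M) - e"] \<open>e > 0\<close>
    obtain n where n: "(\<Sum>i<n. measure M (F i)) > measure M (space M) - e"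
      by (auto simp: eventually_sequentially)
    have FU: "measure M (\<Union>i<n. F i) = (\<Sum>i<n. measure M (F i))"
      by (rule finite_measure_finite_Union) (use disj in \<open>auto intro: disjoint_family_on_mono\<close>)
    define R where "R = space M - (\<Union>i<n. F i)"
    have R_sets [measurable]: "R \<in> sets M" unfolding R_def by measurable
    have "measure M R < e"
      unfolding R_def using n by (subst finite_measure_compl) (auto simp: FU)
    define S where "S = (\<Sum>i<n. measure M (F i) *\<^sub>R c i)"
    have "S \<in> K"
      unfolding S_def
    proof (rule convex_sum_le_1[OF K(2,3)])
      have "measure M (\<Union>i<n. F i) \<le> measure M (space M)"
        by (rule bounded_measure)
      then show "(\<Sum>i<n. measure M (F i)) \<le> 1" using mass' FU by simp
    qed (use cK in auto)
    moreover have "dist S g \<le> 2 * e"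
    proof (rule dist_bound)
      fix x
      define s where "s = (\<lambda>t. \<Sum>i<n. indicator (F i) t * apply_bcontfun (c i) x)"
      have s_int: "integrable M s" unfolding s_def
        by (intro Bochner_Integration.integrable_sum integrable_mult_left) (simp add: integrable_indicator_iff less_top[symmetric])
      have "(LINT t|M. s t) = (\<Sum>i<n. measure M (F i) * apply_bcontfun (c i) x)"
        unfolding s_def
        by (subst Bochner_Integration.integral_sum) (auto simp: integrable_indicator_iff less_top[symmetric])
      then have s_eq: "(LINT t|M. s t) = apply_bcontfun S x"
        unfolding S_def by (simp add: apply_bcontfun_sum)
      have \<Phi>_le: "\<bar>apply_bcontfun (\<Phi> t) x\<bar> \<le> 1" if "t \<in> space M" for t
        using norm_bounded[of "\<Phi> t" x] K(4)[OF \<Phi>[OF that]] by simp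
      have \<Phi>_int: "integrable M (\<lambda>t. apply_bcontfun (\<Phi> t) x)"
        by (rule integrable_const_bound[where B = 1]) (use \<Phi>_le meas in auto)
      have pointwise: "\<bar>apply_bcontfun (\<Phi> t) x - s t\<bar> \<le> e + indicator R t" if t: "t \<in> space M" for t
      proof (cases "t \<in> R")
        case True
        then have "s t = 0" unfolding s_def R_def by (auto intro!: sum.neutral)
        then show ?thesis using \<Phi>_le[OF t] True \<open>e > 0\<close> by simp
      next
        case False
        then obtain j where j: "j < n" "t \<in> F j" using t unfolding R_def by auto
        have "s t = (\<Sum>i<n. if i = j then apply_bcontfun (c j) x else 0)"
          unfolding s_def using j disj
          by (intro sum.cong refl) (auto simp: disjoint_family_on_def indicator_def)
        then have "s t = apply_bcontfun (c j) x" using j by simp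
        moreover have "\<bar>apply_bcontfun (\<Phi> t) x - apply_bcontfun (c j) x\<bar> < e"
          using j(2) FE[of j] dist_fun_lt_imp_dist_val_lt[of "\<Phi> t" "c j" e x]
          by (auto simp: E_def dist_real_def)
        ultimately show ?thesis using False by simp
      qed
      have "\<bar>(LINT t|M. apply_bcontfun (\<Phi> t) x) - (LINT t|M. s t)\<bar>
        = \<bar>LINT t|M. apply_bcontfun (\<Phi> t) x - s t\<bar>"
        by (simp add: \<Phi>_int s_int)
      also have "\<dots> \<le> (LINT t|M. \<bar>apply_bcontfun (\<Phi> t) x - s t\<bar>)" by (rule integral_abs_bound)
      also have "\<dots> \<le> (LINT t|M. e + indicator R t)"
        using pointwise by (intro integral_mono integrable_abs Bochner_Integration.integrable_diff
          Bochner_Integration.integrable_add \<Phi>_int s_int)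
          (auto simp: integrable_indicator_iff less_top[symmetric])
      also have "\<dots> = e * measure M (space M) + measure M R"
        using R_sets by (subst Bochner_Integration.integral_add)
          (auto simp: integrable_indicator_iff less_top[symmetric])
      also have "\<dots> \<le> e * 1 + e"
        using \<open>measure M R < e\<close> mass' \<open>e > 0\<close> by (intro add_mono mult_left_mono) auto
      finally show "dist (apply_bcontfun S x) (apply_bcontfun g x) \<le> 2 * e"
        by (simp add: dist_real_def s_eq g abs_minus_commute)
    qed
    ultimately show ?thesis by blast
  qed
  have "g \<in> closure K"
    unfolding closure_approachable
  proof (intro allI impI)
    fix e :: real assume "e > 0"
    then obtain S where "S \<in> K" "dist S g \<le> 2 * (e / 4)" using approx[of "e / 4"] by auto
    then show "\<exists>y\<in>K. dist y g < e" using \<open>e > 0\<close> by (intro bexI[of _ S]) auto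
  qed
  then show ?thesis using K(1) by simp
qed

lemma bounded_bilinear_bcontfun_mult:
  "bounded_bilinear (bcontfun_mult :: ('a::topological_space \<Rightarrow>\<^sub>C real) \<Rightarrow> _)"
proof
  fix f f' g g' :: "'a \<Rightarrow>\<^sub>C real" and r :: real
  show "bcontfun_mult (f + f') g = bcontfun_mult f g + bcontfun_mult f' g"
    "bcontfun_mult f (g + g') = bcontfun_mult f g + bcontfun_mult f g'"
    "bcontfun_mult (r *\<^sub>R f) g = r *\<^sub>R bcontfun_mult f g"
    "bcontfun_mult f (r *\<^sub>R g) = r *\<^sub>R bcontfun_mult f g"
    by (auto intro!: bcontfun_eqI simp: algebra_simps)
  show "\<exists>K. \<forall>a b. norm (bcontfun_mult a b :: 'a \<Rightarrow>\<^sub>C real) \<le> norm a * norm b * K"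
  proof (intro exI[of _ 1] allI)
    fix a b :: "'a \<Rightarrow>\<^sub>C real"
    have "norm (apply_bcontfun (bcontfun_mult a b) x) \<le> norm a * norm b" for x
      unfolding apply_bcontfun_mult norm_mult by (intro mult_mono norm_bounded) auto
    then show "norm (bcontfun_mult a b) \<le> norm a * norm b * 1" by (simp add: norm_bound)
  qed
qed

section \<open>Products of cubic convolutions\<close>

lemma cube_dot_restrict_add:
  "cube_dot k \<alpha> (\<lambda>i\<in>{..<k}. h i + t i) = cube_dot k \<alpha> h + cube_dot k \<alpha> t"
  unfolding cube_dot_def by (simp add: scaleR_add_right sum.distrib)

lemma PiM_lborel_translate:
  fixes h :: "nat \<Rightarrow> 'a::euclidean_space" and k :: nat
  defines "M \<equiv> PiM {..<k} (\<lambda>_. lborel :: 'a measure)"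
  shows "distr M M (\<lambda>t. \<lambda>i\<in>{..<k}. h i + t i) = M"
proof -
  interpret product_sigma_finite "\<lambda>_::nat. lborel :: 'a measure" by standard
  have T [measurable]: "(\<lambda>t. \<lambda>i\<in>{..<k}. h i + t i) \<in> measurable M M"
    unfolding M_def by measurable
  have "distr M M (\<lambda>t. \<lambda>i\<in>{..<k}. h i + t i) = PiM {..<k} (\<lambda>_. lborel)"
  proof (rule PiM_eqI)
    fix A :: "nat \<Rightarrow> 'a set"
    assume "\<And>i. i \<in> {..<k} \<Longrightarrow> A i \<in> sets lborel"
    then have A: "A i \<in> sets borel" if "i < k" for i using that by simp
    have PiE_A: "Pi\<^sub>E {..<k} A \<in> sets M" unfolding M_def using A by (intro sets_PiM_I_finite) auto
    have shift: "(+) (h i) -` A i \<in> sets borel" if "i < k" for i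
      using measurable_sets[of "(+) (h i)" borel borel, OF _ A[OF that]] by simp
    have "emeasure (distr M M (\<lambda>t. \<lambda>i\<in>{..<k}. h i + t i)) (Pi\<^sub>E {..<k} A)
      = emeasure M (Pi\<^sub>E {..<k} (\<lambda>i. (+) (h i) -` A i))"
      by (subst emeasure_distr[OF T PiE_A], rule arg_cong[where f = "emeasure M"])
        (auto simp: M_def space_PiM PiE_iff)
    also have "\<dots> = (\<Prod>i<k. emeasure lborel ((+) (h i) -` A i))"
      unfolding M_def using shift by (intro emeasure_PiM) auto
    also have "\<dots> = (\<Prod>i<k. emeasure lborel (A i))"
    proof (intro prod.cong refl)
      fix i assume "i \<in> {..<k}"
      then show "emeasure lborel ((+) (h i) -` A i) = emeasure lborel (A i)"
        using emeasure_distr[of "(+) (h i)" lborel borel "A i"] A by (simp add: lborel_distr_plus)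
    qed
    finally show "emeasure (distr M M (\<lambda>t. \<lambda>i\<in>{..<k}. h i + t i)) (Pi\<^sub>E {..<k} A)
      = (\<Prod>i\<in>{..<k}. emeasure lborel (A i))" .
  qed (simp_all add: M_def)
  then show ?thesis by (simp add: M_def)
qed

text \<open>For fixed \<open>h\<close> replace the integration variable of the second factor by \<open>h + t\<close>, and exchange the order of integration.
  The restriction in \<open>T\<close> keeps the sum inside the space of the product measure.\<close>

lemma cubic_conv_mult:
  fixes f f' :: "(nat \<Rightarrow> real) \<Rightarrow> 'a::euclidean_space \<Rightarrow> real"
  assumes k: "k \<ge> 1" and f: "\<And>\<alpha>. \<alpha> \<in> cube_vertices k \<Longrightarrow> f \<alpha> \<in> Lq (q_exp k)"
    and f': "\<And>\<alpha>. \<alpha> \<in> cube_vertices k \<Longrightarrow> f' \<alpha> \<in> Lq (q_exp k)"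
  shows "cubic_conv k f x * cubic_conv k f' x
    = (LINT t|PiM {..<k} (\<lambda>_. lborel). cubic_conv k (\<lambda>\<alpha> y. f \<alpha> y * f' \<alpha> (y + cube_dot k \<alpha> t)) x)"
proof -
  let ?V = "cube_vertices k" and ?M = "PiM {..<k} (\<lambda>_. lborel :: 'a measure)"
  interpret product_sigma_finite "\<lambda>_::nat. lborel :: 'a measure" by standard
  interpret M: sigma_finite_measure ?M by (rule sigma_finite) simp
  interpret MM: pair_sigma_finite ?M ?M ..
  have [measurable]: "\<And>\<alpha>. \<alpha> \<in> ?V \<Longrightarrow> f \<alpha> \<in> borel_measurable borel"
    "\<And>\<alpha>. \<alpha> \<in> ?V \<Longrightarrow> f' \<alpha> \<in> borel_measurable borel" using f f' by (auto intro: Lq_measurable)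
  define P where "P = (\<lambda>h. \<Prod>\<alpha>\<in>?V. f \<alpha> (x + cube_dot k \<alpha> h))"
  define P' where "P' = (\<lambda>h. \<Prod>\<alpha>\<in>?V. f' \<alpha> (x + cube_dot k \<alpha> h))"
  define T where "T = (\<lambda>h t :: nat \<Rightarrow> 'a. \<lambda>i\<in>{..<k}. h i + t i)"
  have P_int: "integrable ?M P" and P'_int: "integrable ?M P'"
    unfolding P_def P'_def using integrable_cubic[OF k] f f' by blast+
  have T_meas: "T h \<in> measurable ?M ?M" for h unfolding T_def by measurable
  \<comment> \<open>Translation invariance of the product measure.\<close>
  have distr: "distr ?M ?M (T h) = ?M" for h unfolding T_def by (rule PiM_lborel_translate)
  have P'_shift: "P' (T h t) = (\<Prod>\<alpha>\<in>?V. f' \<alpha> (x + cube_dot k \<alpha> h + cube_dot k \<alpha> t))" for h t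
    unfolding P'_def T_def cube_dot_restrict_add by (simp add: add.assoc)
  have shift_int: "integrable ?M (\<lambda>t. P' (T h t))" for h
    using integrable_distr[OF T_meas[of h], of P'] P'_int by (simp add: distr)
  have shift_eq: "(LINT t|?M. u (P' (T h t))) = (LINT t|?M. u (P' t))"
    if "u \<in> borel_measurable borel" for u :: "real \<Rightarrow> real" and h
    using integral_distr[OF T_meas[of h], of "\<lambda>t. u (P' t)"] P'_int that by (simp add: distr)
  have joint: "integrable (?M \<Otimes>\<^sub>M ?M) (\<lambda>(h, t). P h * P' (T h t))"
  proof (rule MM.Fubini_integrable)
    show "(\<lambda>(h, t). P h * P' (T h t)) \<in> borel_measurable (?M \<Otimes>\<^sub>M ?M)"
      unfolding P'_shift unfolding P_def by measurable
    have "(LINT t|?M. norm (case (h, t) of (h, t) \<Rightarrow> P h * P' (T h t))) = \<bar>P h\<bar> * (LINT t|?M. \<bar>P' t\<bar>)" for h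
      using shift_eq[of abs h] by (simp add: abs_mult)
    then show "integrable ?M (\<lambda>h. LINT t|?M. norm (case (h, t) of (h, t) \<Rightarrow> P h * P' (T h t)))"
      using P_int by simp
    show "AE h in ?M. integrable ?M (\<lambda>t. case (h, t) of (h, t) \<Rightarrow> P h * P' (T h t))"
      using shift_int by simp
  qed
  have "cubic_conv k f x * cubic_conv k f' x = (LINT h|?M. P h * (LINT t|?M. P' t))"
    unfolding cubic_conv_def P_def P'_def by simp
  also have "\<dots> = (LINT h|?M. (LINT t|?M. P h * P' (T h t)))"
    using shift_eq[of "\<lambda>u. u"] by simp
  also have "\<dots> = (LINT t|?M. (LINT h|?M. P h * P' (T h t)))"
    by (rule MM.Fubini_integral[OF joint, symmetric])
  finally show ?thesis
    unfolding cubic_conv_def P'_shift P_def by (simp add: prod.distrib)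
qed

lemma continuous_cube_dot: "continuous_on UNIV (\<lambda>t::nat \<Rightarrow> 'a::euclidean_space. cube_dot k \<alpha> t)"
  unfolding cube_dot_def by (intro continuous_intros continuous_on_product_coordinates)

text \<open>Relates the product topology on all sequences to the product measure on the first \<open>k\<close> coordinates: on the space of the
  latter the remaining coordinates are constant.\<close>

lemma PiM_measurable_open:
  fixes U :: "(nat \<Rightarrow> 'a::euclidean_space) set"
  assumes "open U"
  shows "U \<inter> space (PiM {..<k} (\<lambda>_. lborel)) \<in> sets (PiM {..<k} (\<lambda>_. lborel))"
proof -
  let ?M = "PiM {..<k} (\<lambda>_. lborel :: 'a measure)"
  have "(\<lambda>t. t) \<in> borel_measurable ?M"
  proof (rule measurable_coordinatewise_then_product)
    fix i
    show "(\<lambda>t. t i) \<in> borel_measurable ?M"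
    proof (cases "i < k")
      case False
      then have "t i = undefined" if "t \<in> space ?M" for t
        using that by (auto simp: space_PiM PiE_def extensional_def)
      then show ?thesis by (subst measurable_cong[where g = "\<lambda>_. undefined"]) auto
    qed measurable
  qed
  from measurable_sets[OF this borel_open[OF assms]] show ?thesis by (simp add: Int_commute)
qed

lemma test_function_shift_mult:
  assumes "test_function f" "test_function g"
  shows "test_function (\<lambda>y. f y * g (y + u))"
  unfolding test_function_def
proof
  show "continuous_on UNIV (\<lambda>y. f y * g (y + u))"
    by (intro continuous_on_mult test_function_continuous assms
        continuous_on_compose2[OF test_function_continuous[OF assms(2)]] continuous_intros) auto
qed (use assms(1) in \<open>auto simp: test_function_def\<close>)

lemma Lq_norm_shift_mult_tendsto:
  fixes f g :: "'a::euclidean_space \<Rightarrow> real"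
  assumes f: "test_function f" and g: "test_function g" and "q > 0" and u: "u \<longlonglongrightarrow> v"
  shows "(\<lambda>n. Lq_norm q (\<lambda>y. f y * g (y + u n))) \<longlonglongrightarrow> Lq_norm q (\<lambda>y. f y * g (y + v))"
    and "(\<lambda>n. Lq_norm q (\<lambda>y. f y * g (y + u n) - f y * g (y + v))) \<longlonglongrightarrow> 0"
proof -
  obtain b r where b: "b \<ge> 0" "\<And>y. \<bar>f y\<bar> \<le> b * indicator (cball 0 r) y"
    using test_function_bound[OF f] by metis
  obtain c s where c: "c \<ge> 0" "\<And>y. \<bar>g y\<bar> \<le> c * indicator (cball 0 s) y"
    using test_function_bound[OF g] by metis
  have [measurable]: "f \<in> borel_measurable borel" "g \<in> borel_measurable borel"
    using f g by (auto intro: test_function_measurable)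
  have g_le: "\<bar>g y\<bar> \<le> c" for y using c(2)[of y] c(1) by (cases "y \<in> cball 0 s") auto
  have lim: "(\<lambda>n. f y * g (y + u n)) \<longlonglongrightarrow> f y * g (y + v)" for y
    by (intro tendsto_mult tendsto_const continuous_on_tendsto_compose[OF
          test_function_continuous[OF g]] tendsto_add u) auto
  have bound: "\<bar>f y * g (y + w)\<bar> \<le> b * c * indicator (cball 0 r) y" for y w
    unfolding abs_mult using mult_mono[OF b(2)[of y] g_le[of "y + w"]] b(1) by (simp add: mult_ac)
  show "(\<lambda>n. Lq_norm q (\<lambda>y. f y * g (y + u n))) \<longlonglongrightarrow> Lq_norm q (\<lambda>y. f y * g (y + v))"
    by (rule Lq_norm_dominated_convergence[OF \<open>q > 0\<close> Lq_indicator_cball _ _ AE_I2[OF lim] bound])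
      measurable
  have "(\<lambda>n. Lq_norm q (\<lambda>y. f y * g (y + u n) - f y * g (y + v))) \<longlonglongrightarrow> Lq_norm q (\<lambda>y::'a. 0)"
  proof (rule Lq_norm_dominated_convergence[OF \<open>q > 0\<close> Lq_indicator_cball[of "2 * (b * c)" r]
        _ _ AE_I2[OF LIM_zero[OF lim]]])
    show "\<bar>f y * g (y + u n) - f y * g (y + v)\<bar> \<le> 2 * (b * c) * indicator (cball 0 r) y" for n y
      using bound[of y "u n"] bound[of y v] by (cases "y \<in> cball 0 r") auto
  qed measurable
  then show "(\<lambda>n. Lq_norm q (\<lambda>y. f y * g (y + u n) - f y * g (y + v))) \<longlonglongrightarrow> 0"
    using \<open>q > 0\<close> by (simp add: Lq_norm_def)
qed

text \<open>The \<open>q\<close>-th power of \<open>U\<close> is the correlation of \<open>\<bar>f\<bar>\<^sup>q\<close> with \<open>\<bar>g\<bar>\<^sup>q\<close>, whose integral factorises.\<close>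

lemma Lq_correlation:
  fixes f g :: "'a::euclidean_space \<Rightarrow> real"
  assumes "q > 0" and f: "f \<in> Lq q" and g: "g \<in> Lq q"
    and fg: "\<And>u. (\<lambda>y. f y * g (y + u)) \<in> Lq q"
  defines "U \<equiv> \<lambda>u. Lq_norm q (\<lambda>y. f y * g (y + u))"
  shows "U \<in> Lq q" and "Lq_norm q U = Lq_norm q f * Lq_norm q g"
proof -
  have [measurable]: "f \<in> borel_measurable borel" "g \<in> borel_measurable borel"
    using f g by (auto intro: Lq_measurable)
  have U_powr: "\<bar>U u\<bar> powr q = (LINT y|lborel. \<bar>f y * g (y + u)\<bar> powr q)" for u
    using \<open>q > 0\<close> by (simp add: U_def Lq_norm_def powr_powr)
  have U_meas [measurable]: "U \<in> borel_measurable borel" unfolding U_def Lq_norm_def by measurable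
  have nn: "(\<integral>\<^sup>+u. ennreal (\<bar>U u\<bar> powr q) \<partial>lborel)
    = ennreal ((LINT y|lborel. \<bar>f y\<bar> powr q) * (LINT y|lborel. \<bar>g y\<bar> powr q))"
  proof -
    have "(\<integral>\<^sup>+u. ennreal (\<bar>U u\<bar> powr q) \<partial>lborel)
      = (\<integral>\<^sup>+u. (\<integral>\<^sup>+y. ennreal (\<bar>f y\<bar> powr q) * ennreal (\<bar>g (y + u)\<bar> powr q) \<partial>lborel) \<partial>lborel)"
      unfolding U_powr nn_integral_Lq[OF fg, symmetric]
      by (simp add: abs_mult powr_mult ennreal_mult)
    also have "\<dots> = (\<integral>\<^sup>+y. ennreal (\<bar>f y\<bar> powr q) \<partial>lborel) * (\<integral>\<^sup>+y. ennreal (\<bar>g y\<bar> powr q) \<partial>lborel)"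
      by (rule nn_integral_correlation) measurable
    finally show ?thesis by (simp add: nn_integral_Lq f g ennreal_mult)
  qed
  then show U: "U \<in> Lq q" by (intro LqI integrableI_bounded) auto
  have "(LINT u|lborel. \<bar>U u\<bar> powr q) = (LINT y|lborel. \<bar>f y\<bar> powr q) * (LINT y|lborel. \<bar>g y\<bar> powr q)"
    using nn unfolding nn_integral_Lq[OF U] by (subst (asm) ennreal_inj) auto
  then show "Lq_norm q U = Lq_norm q f * Lq_norm q g"
    unfolding Lq_norm_def by (simp add: powr_mult)
qed

lemma cube_vertices_nonempty: "k \<ge> 1 \<Longrightarrow> cube_vertices k \<noteq> {}"
  using cube_vertices_zero_updI[of "k - 1"] by auto

definition K_generators :: "nat \<Rightarrow> ('a::euclidean_space \<Rightarrow>\<^sub>C real) set" where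
  "K_generators k = {g. \<exists>f. (\<forall>\<alpha>\<in>cube_vertices k. f \<alpha> \<in> Lq (q_exp k)) \<and>
     (\<Prod>\<alpha>\<in>cube_vertices k. Lq_norm (q_exp k) (f \<alpha>)) \<le> 1 \<and> apply_bcontfun g = cubic_conv k f}"

lemma K_set_eq: "K_set k = convex hull K_generators k"
  by (simp add: K_set_def K_generators_def)

text \<open>Scaling a single one of the functions scales the product. This gives membership after normalisation, symmetry
  (\<open>c = -1\<close>) and the zero function (\<open>c = 0\<close>).\<close>

lemma K_generators_scaleR:
  assumes k: "k \<ge> 1" and f: "\<And>\<alpha>. \<alpha> \<in> cube_vertices k \<Longrightarrow> f \<alpha> \<in> Lq (q_exp k)"
    and le: "\<bar>c\<bar> * (\<Prod>\<alpha>\<in>cube_vertices k. Lq_norm (q_exp k) (f \<alpha>)) \<le> 1"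
    and g: "apply_bcontfun g = cubic_conv k f"
  shows "c *\<^sub>R g \<in> K_generators k"
proof -
  let ?V = "cube_vertices k"
  obtain \<gamma> where \<gamma>: "\<gamma> \<in> ?V" using cube_vertices_nonempty[OF k] by blast
  have q: "q_exp k > 0" using q_exp_ge_1[OF k] by simp
  define f' where "f' = (\<lambda>\<alpha> y. (if \<alpha> = \<gamma> then c else 1) * f \<alpha> y)"
  have factor: "(\<Prod>\<alpha>\<in>?V. (if \<alpha> = \<gamma> then b else 1) * p \<alpha>) = b * prod p ?V" for b :: real and p
    using \<gamma> by (simp add: prod.distrib finite_cube_vertices)
  have "f' \<alpha> \<in> Lq (q_exp k)" if "\<alpha> \<in> ?V" for \<alpha> unfolding f'_def by (intro Lq_cmult f that)
  moreover have "(\<Prod>\<alpha>\<in>?V. Lq_norm (q_exp k) (f' \<alpha>)) \<le> 1"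
  proof -
    have "Lq_norm (q_exp k) (f' \<alpha>) = (if \<alpha> = \<gamma> then \<bar>c\<bar> else 1) * Lq_norm (q_exp k) (f \<alpha>)" for \<alpha>
      unfolding f'_def Lq_norm_cmult[OF q] by simp
    then show ?thesis using le by (simp add: factor)
  qed
  moreover have "apply_bcontfun (c *\<^sub>R g) = cubic_conv k f'"
    by (rule ext) (simp add: g cubic_conv_def f'_def factor)
  ultimately show ?thesis unfolding K_generators_def by blast
qed

lemma zero_in_K_generators:
  assumes k: "k \<ge> 1"
  shows "0 \<in> K_generators k"
proof -
  have q: "q_exp k > 0" using q_exp_ge_1[OF k] by simp
  have t: "test_function (\<lambda>_. 0)" by (simp add: test_function_def)
  have "0 *\<^sub>R Bcontfun (cubic_conv k (\<lambda>_ _. 0)) \<in> K_generators k"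
    by (rule K_generators_scaleR[OF k test_function_Lq[OF t q] _ cubic_conv_bcontfun[OF k t]]) simp
  then show ?thesis by simp
qed

lemma banach_disc_closure_K_set:
  assumes k: "k \<ge> 1"
  shows "banach_disc (closure (K_set k :: ('a::euclidean_space \<Rightarrow>\<^sub>C real) set))"
proof
  let ?K = "K_set k :: ('a \<Rightarrow>\<^sub>C real) set"
  have gen: "K_generators k \<subseteq> ?K" unfolding K_set_eq by (rule hull_subset)
  show "closed (closure ?K)" by simp
  show conv: "convex (closure ?K)" unfolding K_set_eq by (intro convex_closure convex_convex_hull)
  show "0 \<in> closure ?K" using zero_in_K_generators[OF k] gen closure_subset by blast
  show "- x \<in> closure ?K" if "x \<in> closure ?K" for x
  proof (rule linear_closure_convex_hull[of uminus])
    show "bounded_linear uminus" by (rule bounded_linear_minus[OF bounded_linear_ident])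
    show "- g \<in> closure ?K" if "g \<in> K_generators k" for g :: "'a \<Rightarrow>\<^sub>C real"
    proof -
      have "(-1) *\<^sub>R g \<in> K_generators k"
        using that K_generators_scaleR[OF k, of _ "-1" g] unfolding K_generators_def by auto
      then show ?thesis using gen closure_subset by auto
    qed
  qed (use conv that in \<open>auto simp: K_set_eq\<close>)
  show "norm x \<le> 1" if "x \<in> closure ?K" for x
  proof -
    have "norm g \<le> 1" if g: "g \<in> K_generators k" for g :: "'a \<Rightarrow>\<^sub>C real"
    proof -
      obtain f where f: "\<And>\<alpha>. \<alpha> \<in> cube_vertices k \<Longrightarrow> f \<alpha> \<in> Lq (q_exp k)"
        "(\<Prod>\<alpha>\<in>cube_vertices k. Lq_norm (q_exp k) (f \<alpha>)) \<le> 1" "apply_bcontfun g = cubic_conv k f"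
        using g unfolding K_generators_def by blast
      show ?thesis
        using order_trans[OF abs_cubic_conv_le[where f = f, OF k f(1)] f(2)]
        by (intro norm_bound) (simp add: f(3))
    qed
    then have "closure ?K \<subseteq> cball 0 1"
      unfolding K_set_eq by (intro closure_minimal hull_minimal) auto
    then show ?thesis using that by auto
  qed
qed

text \<open>The heart of the argument. With \<open>\<Psi> t = D (F t)\<close>, the product is \<open>r\<close> times the barycentre of \<open>\<Phi> t = \<Psi> t / N t\<close> for the measure
  \<open>M'\<close> of density \<open>N / r\<close>. Its mass is at most one by the integral inequality applied to \<open>U\<close>. The dense subset of parameters
  provides the centres of the covering balls, since \<open>\<Phi>\<close> is continuous where \<open>N\<close> is positive.\<close>

lemma test_function_products_in_closure_K_set:
  fixes f f' :: "(nat \<Rightarrow> real) \<Rightarrow> 'a::euclidean_space \<Rightarrow> real"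
  assumes k: "k \<ge> 1" and f: "\<And>\<alpha>. \<alpha> \<in> cube_vertices k \<Longrightarrow> test_function (f \<alpha>)"
    and f': "\<And>\<alpha>. \<alpha> \<in> cube_vertices k \<Longrightarrow> test_function (f' \<alpha>)"
    and r: "r > 0" "(\<Prod>\<alpha>\<in>cube_vertices k. Lq_norm (q_exp k) (f \<alpha>))
      * (\<Prod>\<alpha>\<in>cube_vertices k. Lq_norm (q_exp k) (f' \<alpha>)) \<le> r"
  shows "(1 / r) *\<^sub>R bcontfun_mult (Bcontfun (cubic_conv k f)) (Bcontfun (cubic_conv k f'))
    \<in> closure (K_set k)"
proof -
  let ?V = "cube_vertices k" and ?M = "PiM {..<k} (\<lambda>_. lborel :: 'a measure)"
  define q where "q = q_exp k"
  have q: "q > 0" using q_exp_ge_1[OF k] by (simp add: q_def)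
  interpret disc: banach_disc "closure (K_set k) :: ('a \<Rightarrow>\<^sub>C real) set"
    by (rule banach_disc_closure_K_set[OF k])
  interpret product_sigma_finite "\<lambda>_::nat. lborel :: 'a measure" by standard
  interpret M: sigma_finite_measure ?M by (rule sigma_finite) simp
  define F where "F = (\<lambda>t \<alpha> y. f \<alpha> y * f' \<alpha> (y + cube_dot k \<alpha> t))"
  define U where "U = (\<lambda>\<alpha> u. Lq_norm q (\<lambda>y. f \<alpha> y * f' \<alpha> (y + u)))"
  define N where "N = (\<lambda>t. \<Prod>\<alpha>\<in>?V. U \<alpha> (cube_dot k \<alpha> t))"
  define \<Psi> where "\<Psi> = (\<lambda>t. Bcontfun (cubic_conv k (F t)))"
  define \<Phi> where "\<Phi> = (\<lambda>t. if N t > 0 then (1 / N t) *\<^sub>R \<Psi> t else 0)"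
  have [measurable]: "\<And>\<alpha>. \<alpha> \<in> ?V \<Longrightarrow> f \<alpha> \<in> borel_measurable borel"
    "\<And>\<alpha>. \<alpha> \<in> ?V \<Longrightarrow> f' \<alpha> \<in> borel_measurable borel"
    using f f' by (auto intro: test_function_measurable)
  have F_test: "test_function (F t \<alpha>)" if "\<alpha> \<in> ?V" for t \<alpha>
    unfolding F_def by (intro test_function_shift_mult f f' that)
  have F_Lq: "F t \<alpha> \<in> Lq (q_exp k)" if "\<alpha> \<in> ?V" for t \<alpha>
    using test_function_Lq[OF F_test[OF that] q] by (simp add: q_def)
  have \<Psi>: "apply_bcontfun (\<Psi> t) = cubic_conv k (F t)" for t
    unfolding \<Psi>_def by (rule cubic_conv_bcontfun[OF k F_test])
  have N_eq: "N t = (\<Prod>\<alpha>\<in>?V. Lq_norm (q_exp k) (F t \<alpha>))" for t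
    by (simp add: N_def U_def F_def q_def)
  have N_nonneg: "N t \<ge> 0" for t unfolding N_def U_def by (intro prod_nonneg) (simp add: Lq_norm_nonneg)
  have \<Psi>_le: "\<bar>apply_bcontfun (\<Psi> t) x\<bar> \<le> N t" for t x
    unfolding \<Psi> N_eq by (rule abs_cubic_conv_le[OF k F_Lq])
  \<comment> \<open>Where \<open>N t = 0\<close> the function \<open>\<Psi> t\<close> vanishes, so the value of \<open>\<Phi> t\<close> there does not matter.\<close>
  have N_\<Phi>: "N t * apply_bcontfun (\<Phi> t) x = apply_bcontfun (\<Psi> t) x" for t x
    using \<Psi>_le[of t x] N_nonneg[of t] by (cases "N t = 0") (auto simp: \<Phi>_def)
  have \<Phi>_mem: "\<Phi> t \<in> closure (K_set k)" for t
  proof (cases "N t > 0")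
    case True
    have "(1 / N t) *\<^sub>R \<Psi> t \<in> K_generators k"
      by (rule K_generators_scaleR[OF k F_Lq _ \<Psi>]) (use True in \<open>simp_all flip: N_eq\<close>)
    then have "\<Phi> t \<in> K_set k" using True by (simp add: \<Phi>_def K_set_eq hull_inc)
    then show ?thesis using closure_subset by blast
  next
    case False
    then show ?thesis using disc.zero by (simp add: \<Phi>_def)
  qed

  have U_cont: "continuous_on UNIV (U \<alpha>)" if "\<alpha> \<in> ?V" for \<alpha>
    unfolding continuous_on_sequentially U_def comp_def
    using Lq_norm_shift_mult_tendsto(1)[OF f[OF that] f'[OF that] q] by auto
  have N_cont: "continuous_on UNIV N"
    unfolding N_def by (intro continuous_on_prod continuous_on_compose2[OF U_cont continuous_cube_dot]) auto
  have \<Psi>_cont: "continuous_on UNIV \<Psi>"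
    unfolding continuous_on_sequentially comp_def
  proof (intro allI ballI impI)
    fix s and t :: "nat \<Rightarrow> 'a" assume s: "(\<forall>n. s n \<in> UNIV) \<and> s \<longlonglongrightarrow> t"
    have dot: "(\<lambda>n. cube_dot k \<alpha> (s n)) \<longlonglongrightarrow> cube_dot k \<alpha> t" for \<alpha>
      using continuous_on_tendsto_compose[OF continuous_cube_dot, of s t] s by simp
    have "uniform_limit UNIV (\<lambda>n. cubic_conv k (F (s n))) (cubic_conv k (F t)) sequentially"
    proof (rule cubic_conv_uniform_limit[OF k F_Lq F_Lq])
      show "(\<lambda>n. Lq_norm (q_exp k) (\<lambda>y. F (s n) \<alpha> y - F t \<alpha> y)) \<longlonglongrightarrow> 0" if "\<alpha> \<in> ?V" for \<alpha>
        using Lq_norm_shift_mult_tendsto(2)[OF f[OF that] f'[OF that] q dot]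
        by (simp add: F_def q_def)
    qed
    then show "(\<lambda>n. \<Psi> (s n)) \<longlonglongrightarrow> \<Psi> t"
      by (intro uniform_limit_tendsto_bcontfun) (simp add: \<Psi>)
  qed

  have U_meas: "U \<alpha> \<in> borel_measurable borel" if "\<alpha> \<in> ?V" for \<alpha>
    by (rule borel_measurable_continuous_onI[OF U_cont[OF that]])
  have N_meas [measurable]: "N \<in> borel_measurable ?M"
    unfolding N_def using U_meas by measurable
  have \<Psi>_meas: "(\<lambda>t. apply_bcontfun (\<Psi> t) x) \<in> borel_measurable ?M" for x
    unfolding \<Psi> cubic_conv_def F_def by measurable
  have \<Phi>_meas: "(\<lambda>t. apply_bcontfun (\<Phi> t) x) \<in> borel_measurable ?M" for x
  proof -
    have "apply_bcontfun (\<Phi> t) x = (if N t > 0 then apply_bcontfun (\<Psi> t) x / N t else 0)" for t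
      by (simp add: \<Phi>_def)
    then show ?thesis using \<Psi>_meas[of x] by simp
  qed

  define M' where "M' = density ?M (\<lambda>t. ennreal (N t / r))"
  have space_M': "space M' = space ?M" and sets_M': "sets M' = sets ?M"
    by (simp_all add: M'_def)
  have mass: "emeasure M' (space M') \<le> 1"
  proof -
    have "(\<integral>\<^sup>+t. ennreal (N t) \<partial>?M) \<le> ennreal (\<Prod>\<alpha>\<in>?V. Lq_norm (q_exp k) (U \<alpha>))"
    proof -
      have "U \<alpha> \<in> Lq (q_exp k)" if "\<alpha> \<in> ?V" for \<alpha>
        unfolding U_def q_def[symmetric]
        by (intro Lq_correlation(1) q test_function_Lq f f' that test_function_shift_mult)
      from nn_integral_cubic_le[OF k this, where x = 0]
      show ?thesis by (simp add: N_def U_def Lq_norm_nonneg)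
    qed
    also have "(\<Prod>\<alpha>\<in>?V. Lq_norm (q_exp k) (U \<alpha>))
      = (\<Prod>\<alpha>\<in>?V. Lq_norm (q_exp k) (f \<alpha>) * Lq_norm (q_exp k) (f' \<alpha>))"
      unfolding U_def q_def[symmetric]
      by (intro prod.cong refl Lq_correlation(2) q test_function_Lq f f' test_function_shift_mult)
    finally have N_int: "(\<integral>\<^sup>+t. ennreal (N t) \<partial>?M) \<le> ennreal r"
      using r(2) by (auto simp: prod.distrib intro: order_trans ennreal_leI)
    have "emeasure M' (space M') = (\<integral>\<^sup>+t. ennreal (N t / r) \<partial>?M)"
      unfolding M'_def by (simp add: emeasure_density cong: nn_integral_cong)
    also have "\<dots> = (\<integral>\<^sup>+t. ennreal (1 / r) * ennreal (N t) \<partial>?M)"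
      using r(1) N_nonneg by (intro nn_integral_cong) (simp flip: ennreal_mult)
    also have "\<dots> = ennreal (1 / r) * (\<integral>\<^sup>+t. ennreal (N t) \<partial>?M)"
      by (rule nn_integral_cmult) measurable
    also have "\<dots> \<le> ennreal (1 / r) * ennreal r" by (intro mult_left_mono N_int) auto
    also have "\<dots> = 1" using r(1) by (simp flip: ennreal_mult)
    finally show ?thesis .
  qed

  have cover: "\<exists>c :: nat \<Rightarrow> 'a \<Rightarrow>\<^sub>C real. range c \<subseteq> closure (K_set k) \<and>
      (\<forall>i. {t \<in> space M'. dist (\<Phi> t) (c i) < e} \<in> sets M') \<and>
      (\<forall>t\<in>space M'. \<exists>i. dist (\<Phi> t) (c i) < e)" if "e > 0" for e
  proof -
    have pos_open: "open {t. N t > 0}"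
      by (rule open_Collect_less[OF continuous_on_const N_cont])
    have \<Phi>_cont: "continuous_on {t. N t > 0} \<Phi>"
    proof -
      have "continuous_on {t. N t > 0} (\<lambda>t. (1 / N t) *\<^sub>R \<Psi> t)"
        by (intro continuous_intros continuous_on_subset[OF N_cont] continuous_on_subset[OF \<Psi>_cont]) auto
      then show ?thesis by (rule continuous_on_eq) (simp add: \<Phi>_def)
    qed
    have near_open: "open {t. N t > 0 \<and> dist (\<Phi> t) c < e}" for c
    proof -
      have "open ({t. N t > 0} \<inter> \<Phi> -` ball c e)"
        using continuous_open_preimage[OF \<Phi>_cont pos_open, of "ball c e"] by simp
      also have "{t. N t > 0} \<inter> \<Phi> -` ball c e = {t. N t > 0 \<and> dist (\<Phi> t) c < e}"
        by (auto simp: dist_commute)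
      finally show ?thesis .
    qed
    obtain D :: "(nat \<Rightarrow> 'a) set" where D: "countable D"
      "\<And>X. open X \<Longrightarrow> X \<noteq> {} \<Longrightarrow> \<exists>d\<in>D. d \<in> X"
      using countable_dense_exists by blast
    define c where "c = from_nat_into (insert 0 (\<Phi> ` D))"
    have range_c: "range c = insert 0 (\<Phi> ` D)"
      unfolding c_def using D(1) by (intro range_from_nat_into) auto
    have "range c \<subseteq> closure (K_set k)" using range_c \<Phi>_mem disc.zero by auto
    moreover have "{t \<in> space M'. dist (\<Phi> t) (c i) < e} \<in> sets M'" for i
    proof -
      have "{t \<in> space M'. dist (\<Phi> t) (c i) < e}
        = ({t. N t > 0 \<and> dist (\<Phi> t) (c i) < e} \<inter> space ?M)
          \<union> (if dist 0 (c i) < e then {t \<in> space ?M. N t \<le> 0} else {})"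
        by (auto simp: space_M' \<Phi>_def split: if_splits)
      then show ?thesis using PiM_measurable_open[OF near_open[of "c i"]] by (simp add: sets_M')
    qed
    moreover have "\<exists>i. dist (\<Phi> t) (c i) < e" for t
    proof -
      have "\<exists>u\<in>range c. dist (\<Phi> t) u < e"
      proof (cases "N t > 0")
        case True
        then have "t \<in> {s. N s > 0 \<and> dist (\<Phi> s) (\<Phi> t) < e}" using \<open>e > 0\<close> by simp
        then obtain d where "d \<in> D" "dist (\<Phi> d) (\<Phi> t) < e"
          using D(2)[OF near_open[of "\<Phi> t"]] by blast
        then show ?thesis unfolding range_c by (auto simp: dist_commute)
      next
        case False
        then show ?thesis using \<open>e > 0\<close> unfolding range_c by (simp add: \<Phi>_def)
      qed
      then show ?thesis by blast
    qed
    ultimately show ?thesis by blast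
  qed

  show ?thesis
  proof (rule barycentre_mem_closed_convex[OF disc.closed disc.convex disc.zero disc.norm_le_1 mass
        \<Phi>_mem _ cover])
    show "(\<lambda>t. apply_bcontfun (\<Phi> t) x) \<in> borel_measurable M'" for x
      using \<Phi>_meas by (simp add: M'_def)
    fix x
    have "(LINT t|M'. apply_bcontfun (\<Phi> t) x) = (LINT t|?M. (N t / r) * apply_bcontfun (\<Phi> t) x)"
      unfolding M'_def using \<Phi>_meas r(1) N_nonneg by (subst integral_density) auto
    also have "\<dots> = (LINT t|?M. cubic_conv k (F t) x / r)"
      using N_\<Phi> by (intro Bochner_Integration.integral_cong) (simp_all add: \<Psi>)
    also have "\<dots> = (LINT t|?M. cubic_conv k (F t) x) / r" by simp
    also have "\<dots> = cubic_conv k f x * cubic_conv k f' x / r"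
      unfolding F_def
      using cubic_conv_mult[OF k test_function_Lq[OF f] test_function_Lq[OF f'], where x = x] q
      by (simp add: q_def)
    finally show "apply_bcontfun ((1 / r) *\<^sub>R bcontfun_mult (Bcontfun (cubic_conv k f))
        (Bcontfun (cubic_conv k f'))) x = (LINT t|M'. apply_bcontfun (\<Phi> t) x)"
      by (simp add: cubic_conv_bcontfun[OF k f] cubic_conv_bcontfun[OF k f'])
  qed auto
qed

lemma cubic_conv_test_approx:
  fixes f :: "(nat \<Rightarrow> real) \<Rightarrow> 'a::euclidean_space \<Rightarrow> real"
  assumes k: "k \<ge> 1" and f: "\<And>\<alpha>. \<alpha> \<in> cube_vertices k \<Longrightarrow> f \<alpha> \<in> Lq (q_exp k)"
    and g: "apply_bcontfun g = cubic_conv k f"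
  obtains h where "\<And>n \<alpha>. \<alpha> \<in> cube_vertices k \<Longrightarrow> test_function (h n \<alpha>)"
    "(\<lambda>n. Bcontfun (cubic_conv k (h n))) \<longlonglongrightarrow> g"
    "(\<lambda>n. \<Prod>\<alpha>\<in>cube_vertices k. Lq_norm (q_exp k) (h n \<alpha>))
      \<longlonglongrightarrow> (\<Prod>\<alpha>\<in>cube_vertices k. Lq_norm (q_exp k) (f \<alpha>))"
proof -
  have q: "q_exp k > 0" using q_exp_ge_1[OF k] by simp
  have "\<forall>\<alpha>\<in>cube_vertices k. \<exists>h. (\<forall>n. test_function (h n)) \<and>
    (\<lambda>n. Lq_norm (q_exp k) (\<lambda>x. h n x - f \<alpha> x)) \<longlonglongrightarrow> 0 \<and>
    (\<lambda>n. Lq_norm (q_exp k) (h n)) \<longlonglongrightarrow> Lq_norm (q_exp k) (f \<alpha>)"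
  proof
    fix \<alpha> assume "\<alpha> \<in> cube_vertices k"
    from test_functions_dense[OF q f[OF this]] show "\<exists>h. (\<forall>n. test_function (h n)) \<and>
      (\<lambda>n. Lq_norm (q_exp k) (\<lambda>x. h n x - f \<alpha> x)) \<longlonglongrightarrow> 0 \<and>
      (\<lambda>n. Lq_norm (q_exp k) (h n)) \<longlonglongrightarrow> Lq_norm (q_exp k) (f \<alpha>)" by blast
  qed
  from bchoice[OF this] obtain H where H: "\<And>\<alpha> n. \<alpha> \<in> cube_vertices k \<Longrightarrow> test_function (H \<alpha> n)"
    "\<And>\<alpha>. \<alpha> \<in> cube_vertices k \<Longrightarrow> (\<lambda>n. Lq_norm (q_exp k) (\<lambda>x. H \<alpha> n x - f \<alpha> x)) \<longlonglongrightarrow> 0"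
    "\<And>\<alpha>. \<alpha> \<in> cube_vertices k \<Longrightarrow> (\<lambda>n. Lq_norm (q_exp k) (H \<alpha> n)) \<longlonglongrightarrow> Lq_norm (q_exp k) (f \<alpha>)"
    by blast
  show thesis
  proof
    show "test_function (H \<alpha> n)" if "\<alpha> \<in> cube_vertices k" for n \<alpha> by (rule H(1)[OF that])
    have "uniform_limit UNIV (\<lambda>n. cubic_conv k (\<lambda>\<alpha>. H \<alpha> n)) (cubic_conv k f) sequentially"
      by (rule cubic_conv_uniform_limit[OF k f test_function_Lq[OF H(1) q] H(2)])
    then show "(\<lambda>n. Bcontfun (cubic_conv k (\<lambda>\<alpha>. H \<alpha> n))) \<longlonglongrightarrow> g"
      by (intro uniform_limit_tendsto_bcontfun) (simp add: cubic_conv_bcontfun[OF k H(1)] g)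
    show "(\<lambda>n. \<Prod>\<alpha>\<in>cube_vertices k. Lq_norm (q_exp k) (H \<alpha> n))
      \<longlonglongrightarrow> (\<Prod>\<alpha>\<in>cube_vertices k. Lq_norm (q_exp k) (f \<alpha>))"
      by (intro tendsto_prod H(3))
  qed
qed

text \<open>Approximate all functions by test functions. The norms of the approximants may exceed those of the limits slightly, which is
  compensated by the factor \<open>1 / r n\<close>, whose limit is one.\<close>

lemma K_generators_mult:
  fixes g g' :: "'a::euclidean_space \<Rightarrow>\<^sub>C real"
  assumes k: "k \<ge> 1" and g: "g \<in> K_generators k" and g': "g' \<in> K_generators k"
  shows "bcontfun_mult g g' \<in> closure (K_set k)"
proof -
  let ?V = "cube_vertices k" and ?N = "Lq_norm (q_exp k) :: ('a \<Rightarrow> real) \<Rightarrow> real"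
  obtain f where f: "\<And>\<alpha>. \<alpha> \<in> ?V \<Longrightarrow> f \<alpha> \<in> Lq (q_exp k)" "(\<Prod>\<alpha>\<in>?V. ?N (f \<alpha>)) \<le> 1"
    "apply_bcontfun g = cubic_conv k f" using g unfolding K_generators_def by blast
  obtain f' where f': "\<And>\<alpha>. \<alpha> \<in> ?V \<Longrightarrow> f' \<alpha> \<in> Lq (q_exp k)" "(\<Prod>\<alpha>\<in>?V. ?N (f' \<alpha>)) \<le> 1"
    "apply_bcontfun g' = cubic_conv k f'" using g' unfolding K_generators_def by blast
  obtain h where h: "\<And>n \<alpha>. \<alpha> \<in> ?V \<Longrightarrow> test_function (h n \<alpha>)"
    "(\<lambda>n. Bcontfun (cubic_conv k (h n))) \<longlonglongrightarrow> g"
    "(\<lambda>n. \<Prod>\<alpha>\<in>?V. ?N (h n \<alpha>)) \<longlonglongrightarrow> (\<Prod>\<alpha>\<in>?V. ?N (f \<alpha>))"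
    using cubic_conv_test_approx[OF k f(1,3)] by blast
  obtain h' where h': "\<And>n \<alpha>. \<alpha> \<in> ?V \<Longrightarrow> test_function (h' n \<alpha>)"
    "(\<lambda>n. Bcontfun (cubic_conv k (h' n))) \<longlonglongrightarrow> g'"
    "(\<lambda>n. \<Prod>\<alpha>\<in>?V. ?N (h' n \<alpha>)) \<longlonglongrightarrow> (\<Prod>\<alpha>\<in>?V. ?N (f' \<alpha>))"
    using cubic_conv_test_approx[OF k f'(1,3)] by blast
  define r where "r = (\<lambda>n. max 1 ((\<Prod>\<alpha>\<in>?V. ?N (h n \<alpha>)) * (\<Prod>\<alpha>\<in>?V. ?N (h' n \<alpha>))))"
  have "(\<Prod>\<alpha>\<in>?V. ?N (f \<alpha>)) * (\<Prod>\<alpha>\<in>?V. ?N (f' \<alpha>)) \<le> 1"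
    using f(2) f'(2) by (intro mult_le_one prod_nonneg) (auto simp: Lq_norm_nonneg)
  moreover have "r \<longlonglongrightarrow> max 1 ((\<Prod>\<alpha>\<in>?V. ?N (f \<alpha>)) * (\<Prod>\<alpha>\<in>?V. ?N (f' \<alpha>)))"
    unfolding r_def by (intro tendsto_intros h(3) h'(3))
  ultimately have r: "r \<longlonglongrightarrow> 1" by simp
  have "(\<lambda>n. (1 / r n) *\<^sub>R bcontfun_mult (Bcontfun (cubic_conv k (h n))) (Bcontfun (cubic_conv k (h' n))))
    \<longlonglongrightarrow> (1 / 1) *\<^sub>R bcontfun_mult g g'"
    by (intro tendsto_intros r bounded_bilinear.tendsto[OF bounded_bilinear_bcontfun_mult h(2) h'(2)]) auto
  moreover have "(1 / r n) *\<^sub>R bcontfun_mult (Bcontfun (cubic_conv k (h n))) (Bcontfun (cubic_conv k (h' n)))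
    \<in> closure (K_set k)" for n
    by (rule test_function_products_in_closure_K_set[OF k h(1) h'(1)]) (auto simp: r_def)
  ultimately have "(1 / 1) *\<^sub>R bcontfun_mult g g' \<in> closure (K_set k)"
    by (rule closed_sequentially[OF closed_closure, rotated])
  then show ?thesis by simp
qed

theorem banach_algebra_A_space:
  assumes "k \<ge> 1"
  shows "banach_algebra_on (A_space k :: ('a::euclidean_space \<Rightarrow>\<^sub>C real) set) (A_norm k) bcontfun_mult"
proof -
  interpret disc: banach_disc "closure (K_set k) :: ('a \<Rightarrow>\<^sub>C real) set"
    by (rule banach_disc_closure_K_set[OF assms])
  have "bcontfun_mult x y \<in> closure (K_set k)"
    if "x \<in> closure (K_set k)" "y \<in> closure (K_set k)" for x y :: "'a \<Rightarrow>\<^sub>C real"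
    by (rule bilinear_closure_convex_hull[OF bounded_bilinear_bcontfun_mult disc.closed disc.convex
          K_generators_mult[OF assms] that[unfolded K_set_eq]])
  then have "banach_algebra_on (span (closure (K_set k :: ('a \<Rightarrow>\<^sub>C real) set)))
      (gauge_of (closure (K_set k))) bcontfun_mult"
    by (intro disc.banach_algebra_gauge bounded_bilinear_bcontfun_mult)
      (auto intro!: bcontfun_eqI simp: mult.assoc)
  moreover have "gauge_of (closure (K_set k)) = (A_norm k :: ('a \<Rightarrow>\<^sub>C real) \<Rightarrow> real)"
    by (rule ext) (simp add: gauge_of_def A_norm_def)
  ultimately show ?thesis by (simp add: A_space_def)
qed

theorem theorem9:
  fixes k :: nat
  assumes "k \<ge> 2"
  shows "banach_algebra_on (A_space k :: ((real ^ 'd) \<Rightarrow>\<^sub>C real) set) (A_norm k) bcontfun_mult \<and>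
    (\<forall>g1 \<in> (A_space k :: ((real ^ 'd) \<Rightarrow>\<^sub>C real) set). \<forall>g2 \<in> A_space k.
      bcontfun_mult g1 g2 \<in> A_space k \<and>
      A_norm k (bcontfun_mult g1 g2) \<le> A_norm k g1 * A_norm k g2)"
proof -
  have "banach_algebra_on (A_space k :: ((real ^ 'd) \<Rightarrow>\<^sub>C real) set) (A_norm k) bcontfun_mult"
    using assms by (intro banach_algebra_A_space) simp
  then show ?thesis
    using banach_algebra_on.mult_closed banach_algebra_on.norm_mult by blast
qed

end
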